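(* Let $\Phi_k:X_k\to E_k$ be a modular parametrization satisfying $$\Phi_k^*\left(\frac{dx}{2y}\right)=\frac{4\pi i}{k}f_{N,k}(2\tau/k)\,d\tau,$$ and let $Q_k(\tau):=x(\tau)\Delta_{N,k}(\tau)^{4/k}$, where $x(\tau)=x\circ\Phi_k(\tau)$. Then $Q_k(\tau)$ is holomorphic (on $\mathbb{H}$ and at the cusps) if and only if $\Phi_k^{-1}(\mathcal{O})\subset\mathcal{C}$.
   Context: Let $N\ge1$ and $k\in\{4,6,8,12\}$. $E_k/\mathbb{Q}$ is an elliptic curve $y^2=f_k(x)$ with $f_4(x)=x^3+a_2x^2+a_4x+a_6$, $f_6(x)=x^3+b_6$, $f_8(x)=x^3+c_4x$, $f_{12}(x)=x^3+d_6$, all coefficients rational, and $j(E_4)\neq0,1728$. $\mathcal{O}$ is the point at infinity of $E_k$. $f_{N,k}(\tau)\in S_2(\Gamma_0(\tfrac{k^2}{4}N))$ is a newform with rational Fourier coefficients. $\Gamma_k:=\begin{pmatrix}2/k&0\\0&1\end{pmatrix}^{-1}\Gamma_0\!\left(\tfrac{k^2}{4}N\right)\begin{pmatrix}2/k&0\\0&1\end{pmatrix}=\Gamma_0(\tfrac k2N)\cap\Gamma^0(\tfrac k2)$, $X_k$ is the compactification of $\mathbb{H}/\Gamma_k$, and $\mathcal{C}$ is the set of cusps of $X_k$. $\Delta_{N,k}(\tau):=f_{N,k}(2\tau/k)^{k/2}$, with $\Delta_{N,k}^{4/k}:=f_{N,k}(2\tau/k)^2$. $Q_k$ is a meromorphic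 modular form of weight $4$ for $\Gamma_k$. *)

theory Defs
  imports "HOL-Complex_Analysis.Complex_Analysis"
begin

no_notation fps_nth (infixl "$" 75)  (* clashes with vec_nth *)

section \<open>Congruence subgroups and their action on the extended upper half plane\<close>

definition upper_half :: "complex set" where
  "upper_half = {\<tau>. Im \<tau> > 0}"

definition SL2Z :: "(int^2^2) set" where
  "SL2Z = {A. det A = 1}"

definition Gamma0 :: "nat \<Rightarrow> (int^2^2) set" where
  "Gamma0 M = {A \<in> SL2Z. int M dvd A $ 2 $ 1}"

definition Gamma_upper0 :: "nat \<Rightarrow> (int^2^2) set" where
  "Gamma_upper0 M = {A \<in> SL2Z. int M dvd A $ 1 $ 2}"

definition Gamma_k :: "nat \<Rightarrow> nat \<Rightarrow> (int^2^2) set" where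
  "Gamma_k N k = Gamma0 (k div 2 * N) \<inter> Gamma_upper0 (k div 2)"

definition scale_mat :: "nat \<Rightarrow> rat^2^2" where
  "scale_mat k = vector [vector [2 / of_nat k, 0], vector [0, 1]]"

definition rat_mat :: "int^2^2 \<Rightarrow> rat^2^2" where
  "rat_mat A = (\<chi> i j. of_int (A $ i $ j))"

text \<open>\<open>Gamma_k\<close> is the conjugate of \<open>Gamma0 (k^2 / 4 * N)\<close> by \<open>scale_mat k\<close>;
  the conjugation is written without an inverse.\<close>

lemma Gamma_k_conjugate:
  assumes "even k" "k > 0"
  shows "Gamma_k N k =
    {A. \<exists>B \<in> Gamma0 (k\<^sup>2 div 4 * N). scale_mat k ** rat_mat A = rat_mat B ** scale_mat k}"
proof -
  obtain m where m: "k = 2 * m" "m > 0" using assms by (auto elim!: evenE)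
  have k4: "k\<^sup>2 div 4 * N = m * (m * N)" by (simp add: m power2_eq_square)
  have mq: "(of_nat m :: rat) \<noteq> 0" using m by simp
  have key: "scale_mat k ** rat_mat A = rat_mat B ** scale_mat k \<longleftrightarrow>
      A$1$1 = B$1$1 \<and> A$1$2 = int m * B$1$2 \<and> int m * A$2$1 = B$2$1 \<and> A$2$2 = B$2$2"
    (is "?L \<longleftrightarrow> ?R") for A B
  proof -
    have "?L \<longleftrightarrow> (of_int (A$1$1) :: rat) = of_int (B$1$1) \<and>
        (of_int (A$1$2) :: rat) = of_int (int m * B$1$2) \<and>
        (of_int (int m * A$2$1) :: rat) = of_int (B$2$1) \<and>
        (of_int (A$2$2) :: rat) = of_int (B$2$2)"
      using mq
      by (simp add: vec_eq_iff forall_2 matrix_matrix_mult_def sum_2 scale_mat_def rat_mat_def m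
          vector_2 field_simps)
    then show ?thesis by (simp only: of_int_eq_iff)
  qed
  show ?thesis
  proof (intro set_eqI iffI)
    fix A assume "A \<in> Gamma_k N k"
    then have A: "A$1$1 * A$2$2 - A$1$2 * A$2$1 = 1" "int (m * N) dvd A$2$1" "int m dvd A$1$2"
      by (auto simp: Gamma_k_def Gamma0_def Gamma_upper0_def SL2Z_def det_2 m)
    from A(3) obtain b where b: "A$1$2 = int m * b" by auto
    define B :: "int^2^2" where
      "B = vector [vector [A$1$1, b], vector [int m * A$2$1, A$2$2]]"
    have "B \<in> Gamma0 (k\<^sup>2 div 4 * N)"
      using A b unfolding k4
      by (auto simp: Gamma0_def SL2Z_def det_2 B_def vector_2 algebra_simps)
    moreover have "scale_mat k ** rat_mat A = rat_mat B ** scale_mat k"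
      unfolding key by (simp add: B_def vector_2 b)
    ultimately show "A \<in> {A. \<exists>B \<in> Gamma0 (k\<^sup>2 div 4 * N).
        scale_mat k ** rat_mat A = rat_mat B ** scale_mat k}" by blast
  next
    fix A assume "A \<in> {A. \<exists>B \<in> Gamma0 (k\<^sup>2 div 4 * N).
        scale_mat k ** rat_mat A = rat_mat B ** scale_mat k}"
    then obtain B where B: "B \<in> Gamma0 (k\<^sup>2 div 4 * N)"
      "A$1$1 = B$1$1" "A$1$2 = int m * B$1$2" "int m * A$2$1 = B$2$1" "A$2$2 = B$2$2"
      unfolding key by blast
    have d: "B$1$1 * B$2$2 - B$1$2 * B$2$1 = 1" and "int (m * (m * N)) dvd B$2$1"
      using B(1) unfolding k4 by (auto simp: Gamma0_def SL2Z_def det_2)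
    then have "int m * int (m * N) dvd int m * A$2$1" using B(4) by simp
    then have "int (m * N) dvd A$2$1" using m(2) by (subst (asm) dvd_mult_cancel_left) auto
    moreover have "det A = 1" using d B(2,3,5) by (simp add: det_2 B(4)[symmetric] algebra_simps)
    ultimately show "A \<in> Gamma_k N k"
      using B(3) by (simp add: Gamma_k_def Gamma0_def Gamma_upper0_def SL2Z_def m)
  qed
qed

definition moebius :: "int^2^2 \<Rightarrow> complex \<Rightarrow> complex" where
  "moebius A \<tau> = (of_int (A $ 1 $ 1) * \<tau> + of_int (A $ 1 $ 2)) /
                 (of_int (A $ 2 $ 1) * \<tau> + of_int (A $ 2 $ 2))"

text \<open>The Riemann sphere is \<open>complex option\<close>, with \<open>None\<close> the point at infinity.\<close>

fun moebius_ext :: "int^2^2 \<Rightarrow> complex option \<Rightarrow> complex option" where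
  "moebius_ext A None =
     (if A $ 2 $ 1 = 0 then None else Some (of_int (A $ 1 $ 1) / of_int (A $ 2 $ 1)))"
| "moebius_ext A (Some z) =
     (if of_int (A $ 2 $ 1) * z + of_int (A $ 2 $ 2) = 0 then None else Some (moebius A z))"

definition cusp_points :: "complex option set" where
  "cusp_points = insert None (Some ` \<rat>)"

definition orbit :: "(int^2^2) set \<Rightarrow> complex option \<Rightarrow> complex option set" where
  "orbit \<Gamma> p = (\<lambda>A. moebius_ext A p) ` \<Gamma>"

text \<open>The underlying set of the compactified modular curve of \<open>\<Gamma>\<close>. Its complex structure is
  given by the local parameters \<open>elliptic_param\<close> and \<open>cusp_param\<close> below.\<close>

definition modular_curve :: "(int^2^2) set \<Rightarrow> complex option set set" where
  "modular_curve \<Gamma> = orbit \<Gamma> ` (Some ` upper_half \<union> cusp_points)"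

definition cusps :: "(int^2^2) set \<Rightarrow> complex option set set" where
  "cusps \<Gamma> = orbit \<Gamma> ` cusp_points"

text \<open>The orders and widths below are those of the image of \<open>\<Gamma>\<close> in \<open>PSL\<^sub>2(\<int>)\<close>, hence the
  passage to \<open>\<plusminus>\<Gamma>\<close>.\<close>

definition pm :: "(int^2^2) set \<Rightarrow> (int^2^2) set" where
  "pm \<Gamma> = \<Gamma> \<union> uminus ` \<Gamma>"

definition elliptic_order :: "(int^2^2) set \<Rightarrow> complex \<Rightarrow> nat" where
  "elliptic_order \<Gamma> \<tau>\<^sub>0 = card {A \<in> pm \<Gamma>. moebius A \<tau>\<^sub>0 = \<tau>\<^sub>0} div 2"

definition elliptic_param :: "(int^2^2) set \<Rightarrow> complex \<Rightarrow> complex \<Rightarrow> complex" where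
  "elliptic_param \<Gamma> \<tau>\<^sub>0 \<tau> = ((\<tau> - \<tau>\<^sub>0) / (\<tau> - cnj \<tau>\<^sub>0)) ^ elliptic_order \<Gamma> \<tau>\<^sub>0"

text \<open>A cusp is given by some \<open>\<alpha> \<in> SL2Z\<close> sending infinity to it; its width is the least
  \<open>h > 0\<close> such that \<open>\<alpha> T\<^sup>h \<alpha>\<^sup>-\<^sup>1\<close> lies in \<open>\<plusminus>\<Gamma>\<close>.\<close>

definition translation :: "nat \<Rightarrow> int^2^2" where
  "translation h = vector [vector [1, int h], vector [0, 1]]"

definition cusp_width :: "(int^2^2) set \<Rightarrow> int^2^2 \<Rightarrow> nat" where
  "cusp_width \<Gamma> \<alpha> = (LEAST h. h > 0 \<and> (\<exists>A \<in> pm \<Gamma>. A ** \<alpha> = \<alpha> ** translation h))"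

definition cusp_param :: "(int^2^2) set \<Rightarrow> int^2^2 \<Rightarrow> complex \<Rightarrow> complex" where
  "cusp_param \<Gamma> \<alpha> \<tau> = exp (2 * of_real pi * \<i> * \<tau> / of_nat (cusp_width \<Gamma> \<alpha>))"

abbreviation at_i_infinity :: "complex filter" where
  "at_i_infinity \<equiv> filtercomap Im at_top"


section \<open>Modular forms\<close>

definition slash :: "nat \<Rightarrow> (complex \<Rightarrow> complex) \<Rightarrow> int^2^2 \<Rightarrow> complex \<Rightarrow> complex" where
  "slash w f A \<tau> = f (moebius A \<tau>) / (of_int (A $ 2 $ 1) * \<tau> + of_int (A $ 2 $ 2)) ^ w"

definition cusp_expansion ::
  "nat \<Rightarrow> (int^2^2) set \<Rightarrow> (complex \<Rightarrow> complex) \<Rightarrow> int^2^2 \<Rightarrow> (complex \<Rightarrow> complex) \<Rightarrow> bool" where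
  "cusp_expansion w \<Gamma> f \<alpha> G \<longleftrightarrow> G analytic_on {0} \<and>
     (\<forall>\<^sub>F \<tau> in at_i_infinity. slash w f \<alpha> \<tau> = G (cusp_param \<Gamma> \<alpha> \<tau>))"

definition holomorphic_at_cusps :: "nat \<Rightarrow> (int^2^2) set \<Rightarrow> (complex \<Rightarrow> complex) \<Rightarrow> bool" where
  "holomorphic_at_cusps w \<Gamma> f \<longleftrightarrow> (\<forall>\<alpha>\<in>SL2Z. \<exists>G. cusp_expansion w \<Gamma> f \<alpha> G)"

definition cusp_form :: "nat \<Rightarrow> (int^2^2) set \<Rightarrow> (complex \<Rightarrow> complex) \<Rightarrow> bool" where
  "cusp_form w \<Gamma> f \<longleftrightarrow>
     f holomorphic_on upper_half \<and>
     (\<forall>A\<in>\<Gamma>. \<forall>\<tau>\<in>upper_half. slash w f A \<tau> = f \<tau>) \<and>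
     (\<forall>\<alpha>\<in>SL2Z. \<exists>G. cusp_expansion w \<Gamma> f \<alpha> G \<and> G 0 = 0)"

definition fourier_coeffs :: "(complex \<Rightarrow> complex) \<Rightarrow> (nat \<Rightarrow> complex) \<Rightarrow> bool" where
  "fourier_coeffs f a \<longleftrightarrow>
     (\<forall>\<tau>\<in>upper_half. (\<lambda>n. a n * exp (2 * of_real pi * \<i> * of_nat n * \<tau>)) sums f \<tau>)"

definition fundamental_domain :: "complex set" where
  "fundamental_domain = {\<tau>. Im \<tau> > 0 \<and> \<bar>Re \<tau>\<bar> \<le> 1/2 \<and> cmod \<tau> \<ge> 1}"

text \<open>Petersson product (without the normalisation by the volume of the modular curve): the
  integral over a fundamental domain of \<open>\<Gamma>\<close>, cut into translates of the standard one indexed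
  by the right cosets of \<open>\<Gamma>\<close> in \<open>SL2Z\<close>. The representative of a coset is immaterial for
  \<open>\<Gamma>\<close>-modular \<open>f\<close> and \<open>g\<close>. The hyperbolic measure contributes \<open>(Im \<tau>)\<^sup>-\<^sup>2\<close>.\<close>

definition petersson ::
  "nat \<Rightarrow> (int^2^2) set \<Rightarrow> (complex \<Rightarrow> complex) \<Rightarrow> (complex \<Rightarrow> complex) \<Rightarrow> complex" where
  "petersson w \<Gamma> f g =
     (\<Sum>C \<in> (\<lambda>\<alpha>. (\<lambda>A. A ** \<alpha>) ` \<Gamma>) ` SL2Z.
        let \<alpha> = (SOME \<alpha>. \<alpha> \<in> C) in
        set_lebesgue_integral lborel fundamental_domain
          (\<lambda>\<tau>. slash w f \<alpha> \<tau> * cnj (slash w g \<alpha> \<tau>) * of_real (Im \<tau> ^ w / (Im \<tau>)\<^sup>2)))"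

text \<open>The Hecke operator \<open>T\<^sub>n\<close> at level \<open>M\<close> with trivial character, for all \<open>n \<ge> 1\<close>; for primes
  dividing the level it is \<open>U\<^sub>p\<close>.\<close>

definition hecke ::
  "nat \<Rightarrow> nat \<Rightarrow> nat \<Rightarrow> (complex \<Rightarrow> complex) \<Rightarrow> complex \<Rightarrow> complex" where
  "hecke w M n f \<tau> =
     (\<Sum>d | d dvd n \<and> coprime (n div d) M. \<Sum>b<d.
        of_nat n ^ (w - 1) / of_nat d ^ w * f ((of_nat (n div d) * \<tau> + of_nat b) / of_nat d))"

definition orthogonal_to_oldforms :: "nat \<Rightarrow> nat \<Rightarrow> (complex \<Rightarrow> complex) \<Rightarrow> bool" where
  "orthogonal_to_oldforms w M f \<longleftrightarrow>
     (\<forall>M' d g. M' dvd M \<and> M' \<noteq> M \<and> d dvd M div M' \<and> cusp_form w (Gamma0 M') g \<longrightarrow>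
        petersson w (Gamma0 M) f (\<lambda>\<tau>. g (of_nat d * \<tau>)) = 0)"

definition newform :: "nat \<Rightarrow> nat \<Rightarrow> (complex \<Rightarrow> complex) \<Rightarrow> bool" where
  "newform w M f \<longleftrightarrow>
     cusp_form w (Gamma0 M) f \<and>
     orthogonal_to_oldforms w M f \<and>
     (\<forall>n\<ge>1. \<exists>c. \<forall>\<tau>\<in>upper_half. hecke w M n f \<tau> = c * f \<tau>) \<and>
     (\<exists>a. fourier_coeffs f a \<and> a 1 = 1)"

definition rational_coeffs :: "(complex \<Rightarrow> complex) \<Rightarrow> bool" where
  "rational_coeffs f \<longleftrightarrow> (\<exists>a. fourier_coeffs f a \<and> (\<forall>n. a n \<in> \<rat>))"

definition Delta :: "nat \<Rightarrow> (complex \<Rightarrow> complex) \<Rightarrow> complex \<Rightarrow> complex" where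
  "Delta k f \<tau> = f (2 * \<tau> / of_nat k) ^ (k div 2)"

text \<open>\<open>Delta_root k f\<close> is the branch \<open>f (2 \<tau> / k)\<^sup>2\<close> of \<open>Delta k f\<close> to the power \<open>4 / k\<close>.\<close>

definition Delta_root :: "nat \<Rightarrow> (complex \<Rightarrow> complex) \<Rightarrow> complex \<Rightarrow> complex" where
  "Delta_root k f \<tau> = f (2 * \<tau> / of_nat k) ^ 2"

lemma Delta_root_power:
  assumes "even k"
  shows "Delta_root k f \<tau> ^ k = Delta k f \<tau> ^ 4"
  using assms by (auto simp: Delta_root_def Delta_def mult.commute power_mult [symmetric] elim!: evenE)


section \<open>Elliptic curves\<close>

text \<open>\<open>Curve a2 a4 a6\<close> stands for \<open>y\<^sup>2 = x\<^sup>3 + a2 x\<^sup>2 + a4 x + a6\<close>.\<close>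

datatype curve = Curve (a2: rat) (a4: rat) (a6: rat)

definition c4_inv :: "curve \<Rightarrow> rat" where
  "c4_inv E = 16 * ((a2 E)\<^sup>2 - 3 * a4 E)"

definition disc :: "curve \<Rightarrow> rat" where
  "disc E = 16 * ((a2 E)\<^sup>2 * (a4 E)\<^sup>2 - 4 * (a4 E)^3 - 4 * (a2 E)^3 * a6 E
                  - 27 * (a6 E)\<^sup>2 + 18 * a2 E * a4 E * a6 E)"

definition j_inv :: "curve \<Rightarrow> rat" where
  "j_inv E = c4_inv E ^ 3 / disc E"

definition elliptic_curve :: "curve \<Rightarrow> bool" where
  "elliptic_curve E \<longleftrightarrow> disc E \<noteq> 0"

definition curve_type :: "nat \<Rightarrow> curve \<Rightarrow> bool" where
  "curve_type k E \<longleftrightarrow>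
     (k = 4 \<and> j_inv E \<noteq> 0 \<and> j_inv E \<noteq> 1728) \<or>
     (k = 6 \<and> (\<exists>b6. E = Curve 0 0 b6)) \<or>
     (k = 8 \<and> (\<exists>c4. E = Curve 0 c4 0)) \<or>
     (k = 12 \<and> (\<exists>d6. E = Curve 0 0 d6))"

definition cubic :: "curve \<Rightarrow> complex poly" where
  "cubic E = [:of_rat (a6 E), of_rat (a4 E), of_rat (a2 E), 1:]"

datatype ec_point = Origin | Affine complex complex

fun on_curve :: "curve \<Rightarrow> ec_point \<Rightarrow> bool" where
  "on_curve E Origin \<longleftrightarrow> True"
| "on_curve E (Affine x y) \<longleftrightarrow> y\<^sup>2 = poly (cubic E) x"

definition complex_points :: "curve \<Rightarrow> ec_point set" where
  "complex_points E = {P. on_curve E P}"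

text \<open>The values of the coordinate functions at their poles are junk.\<close>

fun x_coord :: "ec_point \<Rightarrow> complex" where
  "x_coord Origin = 0"
| "x_coord (Affine x y) = x"

fun y_coord :: "ec_point \<Rightarrow> complex" where
  "y_coord Origin = 0"
| "y_coord (Affine x y) = y"

text \<open>The function \<open>x / y\<close>, which is a local parameter at the origin.\<close>

fun u_coord :: "ec_point \<Rightarrow> complex" where
  "u_coord Origin = 0"
| "u_coord (Affine x y) = x / y"

definition homogeneous_coords :: "curve \<Rightarrow> complex \<Rightarrow> complex \<Rightarrow> complex \<Rightarrow> bool" where
  "homogeneous_coords E X Y Z \<longleftrightarrow> (X, Y, Z) \<noteq> (0, 0, 0) \<and>
     Y\<^sup>2 * Z = X^3 + of_rat (a2 E) * X\<^sup>2 * Z + of_rat (a4 E) * X * Z\<^sup>2 + of_rat (a6 E) * Z^3"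

text \<open>On the curve, \<open>Z = 0\<close> forces \<open>X = 0\<close>, so \<open>[X : Y : 0]\<close> is the origin.\<close>

definition point_of_coords :: "complex \<Rightarrow> complex \<Rightarrow> complex \<Rightarrow> ec_point" where
  "point_of_coords X Y Z = (if Z = 0 then Origin else Affine (X / Z) (Y / Z))"

text \<open>Analyticity as a map into the plane projective curve: locally it lifts to analytic
  homogeneous coordinates without common zeros.\<close>

definition curve_analytic_at :: "curve \<Rightarrow> (complex \<Rightarrow> ec_point) \<Rightarrow> complex \<Rightarrow> bool" where
  "curve_analytic_at E F z\<^sub>0 \<longleftrightarrow>
     (\<exists>X Y Z. X analytic_on {z\<^sub>0} \<and> Y analytic_on {z\<^sub>0} \<and> Z analytic_on {z\<^sub>0} \<and>
        (\<forall>\<^sub>F z in nhds z\<^sub>0. homogeneous_coords E (X z) (Y z) (Z z) \<and>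
           F z = point_of_coords (X z) (Y z) (Z z)))"

text \<open>The coefficient of \<open>d\<tau>\<close> in the pullback of \<open>dx / (2 y)\<close> along \<open>\<phi>\<close>. The differential is
  regular on all of \<open>E\<close>: where \<open>y = 0\<close> it is \<open>dy / f'(x)\<close> for \<open>y\<^sup>2 = f(x)\<close>. Near the origin, with
  \<open>u = x / y\<close> and \<open>v = 1 / y\<close>, it equals \<open>du / (a2 u\<^sup>2 + 2 a4 u v + 3 a6 v\<^sup>2 - 1)\<close>, so at the origin
  it is \<open>- du\<close>.\<close>

definition invariant_differential_pullback ::
  "curve \<Rightarrow> (complex \<Rightarrow> ec_point) \<Rightarrow> complex \<Rightarrow> complex" where
  "invariant_differential_pullback E \<phi> \<tau> =
     (case \<phi> \<tau> of
        Affine x y \<Rightarrow>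
          if y \<noteq> 0 then deriv (\<lambda>t. x_coord (\<phi> t)) \<tau> / (2 * y)
          else deriv (\<lambda>t. y_coord (\<phi> t)) \<tau> / poly (pderiv (cubic E)) x
      | Origin \<Rightarrow> - deriv (\<lambda>t. u_coord (\<phi> t)) \<tau>)"


section \<open>Modular parametrizations\<close>

abbreviation lift ::
  "(int^2^2) set \<Rightarrow> (complex option set \<Rightarrow> ec_point) \<Rightarrow> complex \<Rightarrow> ec_point" where
  "lift \<Gamma> \<Phi> \<tau> \<equiv> \<Phi> (orbit \<Gamma> (Some \<tau>))"

text \<open>Holomorphic maps from the compact Riemann surface \<open>modular_curve \<Gamma>\<close> to \<open>E\<close>: near every
  point the map is an analytic function of the local parameter.\<close>

definition holomorphic_map ::
  "(int^2^2) set \<Rightarrow> curve \<Rightarrow> (complex option set \<Rightarrow> ec_point) \<Rightarrow> bool" where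
  "holomorphic_map \<Gamma> E \<Phi> \<longleftrightarrow>
     \<Phi> ` modular_curve \<Gamma> \<subseteq> complex_points E \<and>
     (\<forall>\<tau>\<^sub>0\<in>upper_half. \<exists>F. curve_analytic_at E F 0 \<and>
        (\<forall>\<^sub>F \<tau> in nhds \<tau>\<^sub>0. lift \<Gamma> \<Phi> \<tau> = F (elliptic_param \<Gamma> \<tau>\<^sub>0 \<tau>))) \<and>
     (\<forall>\<alpha>\<in>SL2Z. \<exists>F. curve_analytic_at E F 0 \<and>
        \<Phi> (orbit \<Gamma> (moebius_ext \<alpha> None)) = F 0 \<and>
        (\<forall>\<^sub>F \<tau> in at_i_infinity. lift \<Gamma> \<Phi> (moebius \<alpha> \<tau>) = F (cusp_param \<Gamma> \<alpha> \<tau>)))"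

definition modular_parametrization ::
  "(int^2^2) set \<Rightarrow> curve \<Rightarrow> (complex option set \<Rightarrow> ec_point) \<Rightarrow> bool" where
  "modular_parametrization \<Gamma> E \<Phi> \<longleftrightarrow>
     holomorphic_map \<Gamma> E \<Phi> \<and> \<not> \<Phi> constant_on modular_curve \<Gamma>"

text \<open>The pointwise product has junk values at the poles of \<open>x\<close>; \<open>remove_sings\<close> turns it into
  the meromorphic function it represents, filling in removable singularities.\<close>

definition Q_form ::
  "nat \<Rightarrow> nat \<Rightarrow> (complex \<Rightarrow> complex) \<Rightarrow> (complex option set \<Rightarrow> ec_point) \<Rightarrow> complex \<Rightarrow> complex" where
  "Q_form N k f \<Phi> =
     remove_sings (\<lambda>\<tau>. x_coord (lift (Gamma_k N k) \<Phi> \<tau>) * Delta_root k f \<tau>)"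

end

theory Submission
  imports Defs
begin

text \<open>Write \<open>\<phi>\<close> for the parametrization as a map from the upper half plane to the curve and
  \<open>\<omega>\<close> for the coefficient of \<open>d\<tau>\<close> in the pullback of \<open>dx / (2 y)\<close>. The hypothesis on the
  differential says \<open>\<omega> = c f (2 \<tau> / k)\<close> with \<open>c \<noteq> 0\<close>, so \<open>Q = (x \<circ> \<phi>) \<omega>\<^sup>2 / c\<^sup>2\<close>: up to a
  constant, \<open>Q d\<tau>\<^sup>2\<close> is the pullback of the quadratic differential \<open>x (dx / 2y)\<^sup>2\<close> of the curve. This
  has its only pole at the origin, a double one: with the local parameter \<open>u = x / y\<close>, it is
  \<open>(du / u)\<^sup>2\<close> times a unit. So for a nonconstant analytic map \<open>F\<close> with \<open>F z\<^sub>0\<close> the origin, the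
  pullback is the square of a logarithmic derivative times a unit and again has a pole of order
  exactly two, whatever the ramification of \<open>F\<close> at \<open>z\<^sub>0\<close>; at all other points it is regular.
  Lemma \<open>x_times_differential_squared\<close> contains this local analysis.

  On the upper half plane the pole is seen as such: \<open>Q\<close> has a double pole at each \<open>\<tau>\<close> with \<open>\<phi> \<tau>\<close>
  the origin, and is holomorphic elsewhere. (A newform does not vanish identically, hence
  \<open>\<phi>\<close> is nowhere locally constant.) At a cusp with parameter \<open>q = exp (2 \<pi> i \<tau> / h)\<close>, on the other
  hand, \<open>d\<tau>\<close> is a constant times \<open>dq / q\<close>, so if \<open>g d\<tau>\<^sup>2\<close> has at most a double
  pole in \<open>q\<close> then \<open>g\<close> is holomorphic in \<open>q\<close>: the cusps impose no condition on \<open>Q\<close>, even if they are mapped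
  to the origin. This is \<open>cusp_expansion_x_differential_squared\<close>; it reads the expansion off the
  parametrization itself, so that no expansion of \<open>f\<close> is ever computed. Hence \<open>Q\<close> is
  holomorphic everywhere iff \<open>\<phi>\<close> avoids the origin on the upper half plane, that is, iff the
  fibre over the origin consists of cusps.\<close>

section \<open>Local analysis of maps into the curve\<close>

lemma eventually_analytic_nhds:
  assumes "f analytic_on {z}"
  shows "\<forall>\<^sub>F w in nhds z. f analytic_on {w}"
proof -
  obtain S where "open S" "z \<in> S" "f holomorphic_on S"
    using assms by (auto simp: analytic_at)
  then show ?thesis
    unfolding eventually_nhds by (metis holomorphic_on_imp_analytic_at)
qed

lemma analytic_eventually_ne:
  fixes f :: "complex \<Rightarrow> complex"
  assumes "f analytic_on {z}" "f z \<noteq> c"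
  shows "\<forall>\<^sub>F w in nhds z. f w \<noteq> c"
  using tendsto_imp_eventually_ne[OF isContD[OF analytic_at_imp_isCont[OF assms(1)]] assms(2)] assms(2)
  by (simp add: eventually_nhds_conv_at)

text \<open>The affine equation of the curve in the chart \<open>u = x / y\<close>, \<open>v = 1 / y\<close> around the origin, which
  is the point \<open>u = v = 0\<close>.\<close>

definition weierstrass_at_infinity :: "curve \<Rightarrow> complex \<Rightarrow> complex \<Rightarrow> bool" where
  "weierstrass_at_infinity E u v \<longleftrightarrow>
     v = u^3 + of_rat (a2 E) * u\<^sup>2 * v + of_rat (a4 E) * u * v\<^sup>2 + of_rat (a6 E) * v^3"

definition point_of_uv :: "complex \<Rightarrow> complex \<Rightarrow> ec_point" where
  "point_of_uv u v = (if v = 0 then Origin else Affine (u / v) (1 / v))"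

text \<open>Analytic maps into the curve are given near each point by one of two pairs of affine coordinates.
  Homogeneous coordinates can be divided by \<open>Z\<close> where \<open>Z \<noteq> 0\<close>; where \<open>Z = 0\<close> the equation forces
  \<open>X = 0\<close>, hence \<open>Y \<noteq> 0\<close>, and they can be divided by \<open>Y\<close>.\<close>

lemma curve_analytic_at_cases:
  assumes "curve_analytic_at E F z\<^sub>0"
  obtains
    (affine) x y where "x analytic_on {z\<^sub>0}" "y analytic_on {z\<^sub>0}"
      "\<forall>\<^sub>F z in nhds z\<^sub>0. F z = Affine (x z) (y z)"
      "\<forall>\<^sub>F z in nhds z\<^sub>0. (y z)\<^sup>2 = poly (cubic E) (x z)"
  | (origin) u v where "u analytic_on {z\<^sub>0}" "v analytic_on {z\<^sub>0}" "u z\<^sub>0 = 0" "v z\<^sub>0 = 0"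
      "\<forall>\<^sub>F z in nhds z\<^sub>0. F z = point_of_uv (u z) (v z)"
      "\<forall>\<^sub>F z in nhds z\<^sub>0. weierstrass_at_infinity E (u z) (v z)"
proof -
  obtain X Y Z where an: "X analytic_on {z\<^sub>0}" "Y analytic_on {z\<^sub>0}" "Z analytic_on {z\<^sub>0}"
    and "\<forall>\<^sub>F z in nhds z\<^sub>0. homogeneous_coords E (X z) (Y z) (Z z) \<and>
           F z = point_of_coords (X z) (Y z) (Z z)"
    using assms unfolding curve_analytic_at_def by blast
  then have hc: "\<forall>\<^sub>F z in nhds z\<^sub>0. homogeneous_coords E (X z) (Y z) (Z z)"
    and F: "\<forall>\<^sub>F z in nhds z\<^sub>0. F z = point_of_coords (X z) (Y z) (Z z)"
    by (auto simp: eventually_conj_iff)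
  show ?thesis
  proof (cases "Z z\<^sub>0 = 0")
    case False
    then have Z: "\<forall>\<^sub>F z in nhds z\<^sub>0. Z z \<noteq> 0"
      by (rule analytic_eventually_ne[OF an(3)])
    show ?thesis
    proof (rule affine)
      show "(\<lambda>z. X z / Z z) analytic_on {z\<^sub>0}" "(\<lambda>z. Y z / Z z) analytic_on {z\<^sub>0}"
        using False by (auto intro!: analytic_intros an)
      show "\<forall>\<^sub>F z in nhds z\<^sub>0. F z = Affine (X z / Z z) (Y z / Z z)"
        using F Z by eventually_elim (simp add: point_of_coords_def)
      show "\<forall>\<^sub>F z in nhds z\<^sub>0. (Y z / Z z)\<^sup>2 = poly (cubic E) (X z / Z z)"
        using hc Z
      proof eventually_elim
        case (elim z)
        then have "(Y z)\<^sup>2 * Z z = (X z)^3 + of_rat (a2 E) * (X z)\<^sup>2 * Z z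
            + of_rat (a4 E) * X z * (Z z)\<^sup>2 + of_rat (a6 E) * (Z z)^3"
          by (simp add: homogeneous_coords_def)
        then have "(Y z / Z z)\<^sup>2 = ((X z)^3 + of_rat (a2 E) * (X z)\<^sup>2 * Z z
            + of_rat (a4 E) * X z * (Z z)\<^sup>2 + of_rat (a6 E) * (Z z)^3) / (Z z)^3"
          using elim(2) by (simp add: field_simps power2_eq_square power3_eq_cube)
        then show ?case
          using elim(2) by (simp add: cubic_def field_simps power2_eq_square power3_eq_cube)
      qed
    qed
  next
    case True
    have hc0: "homogeneous_coords E (X z\<^sub>0) (Y z\<^sub>0) (Z z\<^sub>0)"
      using hc by (rule eventually_nhds_x_imp_x)
    then have X0: "X z\<^sub>0 = 0" and Y0: "Y z\<^sub>0 \<noteq> 0"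
      using True by (auto simp: homogeneous_coords_def)
    have Y: "\<forall>\<^sub>F z in nhds z\<^sub>0. Y z \<noteq> 0"
      using Y0 by (rule analytic_eventually_ne[OF an(2)])
    show ?thesis
    proof (rule origin)
      show "(\<lambda>z. X z / Y z) analytic_on {z\<^sub>0}" "(\<lambda>z. Z z / Y z) analytic_on {z\<^sub>0}"
        using Y0 by (auto intro!: analytic_intros an)
      show "X z\<^sub>0 / Y z\<^sub>0 = 0" "Z z\<^sub>0 / Y z\<^sub>0 = 0" using X0 True by auto
      show "\<forall>\<^sub>F z in nhds z\<^sub>0. F z = point_of_uv (X z / Y z) (Z z / Y z)"
        using F Y by eventually_elim (simp add: point_of_coords_def point_of_uv_def)
      show "\<forall>\<^sub>F z in nhds z\<^sub>0. weierstrass_at_infinity E (X z / Y z) (Z z / Y z)"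
        using hc Y
      proof eventually_elim
        case (elim z)
        then have "(Y z)\<^sup>2 * Z z = (X z)^3 + of_rat (a2 E) * (X z)\<^sup>2 * Z z
            + of_rat (a4 E) * X z * (Z z)\<^sup>2 + of_rat (a6 E) * (Z z)^3"
          by (simp add: homogeneous_coords_def)
        then have "Z z / Y z = ((X z)^3 + of_rat (a2 E) * (X z)\<^sup>2 * Z z
            + of_rat (a4 E) * X z * (Z z)\<^sup>2 + of_rat (a6 E) * (Z z)^3) / (Y z)^3"
          using elim(2) by (simp add: field_simps power2_eq_square power3_eq_cube)
        then show ?case
          using elim(2)
          by (simp add: weierstrass_at_infinity_def field_simps power2_eq_square power3_eq_cube)
      qed
    qed
  qed
qed

lemma u_coord_point_of_uv:
  assumes "weierstrass_at_infinity E u v"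
  shows "u_coord (point_of_uv u v) = u"
  using assms by (auto simp: point_of_uv_def weierstrass_at_infinity_def)

lemma curve_analytic_at_const:
  assumes "on_curve E P"
  shows "curve_analytic_at E (\<lambda>_. P) z"
proof (cases P)
  case Origin
  then show ?thesis
    unfolding curve_analytic_at_def
    by (intro exI[of _ "\<lambda>_. 0"] exI[of _ "\<lambda>_. 1"])
       (auto simp: homogeneous_coords_def point_of_coords_def)
next
  case (Affine x y)
  then show ?thesis
    using assms unfolding curve_analytic_at_def
    by (intro exI[of _ "\<lambda>_. x"] exI[of _ "\<lambda>_. y"] exI[of _ "\<lambda>_. 1"])
       (auto simp: homogeneous_coords_def point_of_coords_def cubic_def
          power2_eq_square power3_eq_cube algebra_simps)
qed

lemma curve_analytic_at_cong:
  assumes "\<forall>\<^sub>F w in nhds z. F w = G w"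
  shows "curve_analytic_at E F z \<longleftrightarrow> curve_analytic_at E G z"
proof -
  have "curve_analytic_at E F z" if G: "curve_analytic_at E G z" and FG: "\<forall>\<^sub>F w in nhds z. F w = G w" for F G
  proof -
    obtain X Y Z where an: "X analytic_on {z}" "Y analytic_on {z}" "Z analytic_on {z}"
      and *: "\<forall>\<^sub>F w in nhds z. homogeneous_coords E (X w) (Y w) (Z w) \<and>
             G w = point_of_coords (X w) (Y w) (Z w)"
      using G unfolding curve_analytic_at_def by blast
    have "\<forall>\<^sub>F w in nhds z. homogeneous_coords E (X w) (Y w) (Z w) \<and>
             F w = point_of_coords (X w) (Y w) (Z w)"
      using * FG by eventually_elim auto
    then show ?thesis using an unfolding curve_analytic_at_def by blast
  qed
  from this[of F G] this[of G F] show ?thesis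
    using assms by (auto simp: eq_commute)
qed

lemma filterlim_analytic_nhds:
  assumes "m analytic_on {t}"
  shows "filterlim m (nhds (m t)) (nhds t)"
  using analytic_at_imp_isCont[OF assms] by (simp add: isCont_def tendsto_nhds_iff)

lemma curve_analytic_at_compose:
  assumes "curve_analytic_at E F (m t)" "m analytic_on {t}"
  shows "curve_analytic_at E (\<lambda>s. F (m s)) t"
proof -
  obtain X Y Z where an: "X analytic_on {m t}" "Y analytic_on {m t}" "Z analytic_on {m t}"
    and *: "\<forall>\<^sub>F w in nhds (m t). homogeneous_coords E (X w) (Y w) (Z w) \<and>
           F w = point_of_coords (X w) (Y w) (Z w)"
    using assms(1) unfolding curve_analytic_at_def by blast
  have comp: "(\<lambda>s. h (m s)) analytic_on {t}" if "h analytic_on {m t}" for h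
    using analytic_on_compose[OF assms(2), of h] that by (simp add: o_def)
  show ?thesis
    unfolding curve_analytic_at_def
    using comp[OF an(1)] comp[OF an(2)] comp[OF an(3)]
      eventually_compose_filterlim[OF * filterlim_analytic_nhds[OF assms(2)]] by blast
qed

lemma eventually_curve_analytic_at:
  assumes "curve_analytic_at E F z"
  shows "\<forall>\<^sub>F w in nhds z. curve_analytic_at E F w"
proof -
  obtain X Y Z where an: "X analytic_on {z}" "Y analytic_on {z}" "Z analytic_on {z}"
    and *: "\<forall>\<^sub>F w in nhds z. homogeneous_coords E (X w) (Y w) (Z w) \<and>
           F w = point_of_coords (X w) (Y w) (Z w)"
    using assms unfolding curve_analytic_at_def by blast
  have "\<forall>\<^sub>F z' in nhds z. \<forall>\<^sub>F w in nhds z'. homogeneous_coords E (X w) (Y w) (Z w) \<and>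
           F w = point_of_coords (X w) (Y w) (Z w)"
    using * by (simp add: eventually_eventually)
  then show ?thesis
    using an[THEN eventually_analytic_nhds]
    by eventually_elim (unfold curve_analytic_at_def, blast)
qed

section \<open>The pullback of the invariant differential\<close>

lemma invariant_differential_pullback_cong:
  assumes "\<forall>\<^sub>F t in nhds \<tau>. \<phi> t = \<psi> t"
  shows "invariant_differential_pullback E \<phi> \<tau> = invariant_differential_pullback E \<psi> \<tau>"
proof -
  have "deriv (\<lambda>t. g (\<phi> t)) \<tau> = deriv (\<lambda>t. g (\<psi> t)) \<tau>" for g :: "ec_point \<Rightarrow> complex"
    using assms by (intro deriv_cong_ev) (auto elim: eventually_mono)
  then show ?thesis
    using eventually_nhds_x_imp_x[OF assms]
    by (auto simp: invariant_differential_pullback_def split: ec_point.split)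
qed

text \<open>The pullback is the derivative of one coordinate function over a factor depending only on the
  point, and the coordinate used is analytic at that point, so this is the ordinary chain rule.\<close>

lemma invariant_differential_pullback_compose:
  assumes F: "curve_analytic_at E F (m t)" and m: "m analytic_on {t}"
  shows "invariant_differential_pullback E (\<lambda>s. F (m s)) t =
         invariant_differential_pullback E F (m t) * deriv m t"
proof -
  have chain: "deriv (\<lambda>s. g (F (m s))) t = deriv (\<lambda>s. g (F s)) (m t) * deriv m t"
    if "h analytic_on {m t}" "\<forall>\<^sub>F s in nhds (m t). g (F s) = h s" for g :: "ec_point \<Rightarrow> complex" and h
  proof -
    have "(\<lambda>s. g (F s)) analytic_on {m t}"
      using that by (simp add: analytic_at_cong)
    then have "((\<lambda>s. g (F s)) \<circ> m has_field_derivative deriv (\<lambda>s. g (F s)) (m t) * deriv m t) (at t)"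
      by (intro DERIV_chain analytic_derivI m)
    then show ?thesis by (simp add: DERIV_imp_deriv o_def)
  qed
  from F show ?thesis
  proof (cases rule: curve_analytic_at_cases)
    case (affine x y)
    have "\<forall>\<^sub>F s in nhds (m t). x_coord (F s) = x s" "\<forall>\<^sub>F s in nhds (m t). y_coord (F s) = y s"
      using affine(3) by (auto elim: eventually_mono)
    then show ?thesis
      using eventually_nhds_x_imp_x[OF affine(3)]
        chain[of x x_coord, OF affine(1)] chain[of y y_coord, OF affine(2)]
      by (simp add: invariant_differential_pullback_def)
  next
    case (origin u v)
    have "\<forall>\<^sub>F s in nhds (m t). u_coord (F s) = u s"
      using origin(5,6) by eventually_elim (simp add: u_coord_point_of_uv)
    moreover have "F (m t) = Origin"
      using eventually_nhds_x_imp_x[OF origin(5)] origin(4) by (simp add: point_of_uv_def)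
    ultimately show ?thesis
      using chain[of u u_coord, OF origin(1)] by (simp add: invariant_differential_pullback_def)
  qed
qed

text \<open>A common root of the cubic and its derivative expresses \<open>a4\<close> and \<open>a6\<close> through the root and \<open>a2\<close>;
  the discriminant then vanishes identically.\<close>

lemma cubic_separable:
  assumes "elliptic_curve E" "poly (cubic E) x = 0"
  shows "poly (pderiv (cubic E)) x \<noteq> 0"
proof
  assume d: "poly (pderiv (cubic E)) x = 0"
  define a b c :: complex where abc_def: "a = of_rat (a2 E)" "b = of_rat (a4 E)" "c = of_rat (a6 E)"
  have "3 * x\<^sup>2 + 2 * a * x + b = 0"
    using d by (simp add: cubic_def pderiv_pCons abc_def algebra_simps power2_eq_square)
  then have b: "b = - 3 * x\<^sup>2 - 2 * a * x"
    by algebra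
  have "x^3 + a * x\<^sup>2 + b * x + c = 0"
    using assms(2) by (simp add: cubic_def abc_def algebra_simps power2_eq_square power3_eq_cube)
  then have c: "c = 2 * x^3 + a * x\<^sup>2"
    unfolding b by algebra
  have "16 * (a\<^sup>2 * b\<^sup>2 - 4 * b^3 - 4 * a^3 * c - 27 * c\<^sup>2 + 18 * a * b * c) = 0"
    unfolding b c by algebra
  also have "16 * (a\<^sup>2 * b\<^sup>2 - 4 * b^3 - 4 * a^3 * c - 27 * c\<^sup>2 + 18 * a * b * c) = of_rat (disc E)"
    by (simp add: disc_def abc_def of_rat_mult of_rat_add of_rat_diff of_rat_power)
  finally show False
    using assms(1) by (simp add: elliptic_curve_def)
qed

text \<open>The pullback is defined pointwise by two different formulas according to whether \<open>y = 0\<close>. Around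
  a point with \<open>y = 0\<close> both agree, because \<open>2 y dy = p'(x) dx\<close> for the cubic \<open>p\<close> and
  \<open>p'(x) \<noteq> 0\<close> by smoothness of the curve.\<close>

lemma invariant_differential_pullback_affine_analytic:
  assumes "elliptic_curve E"
    and x: "x analytic_on {z\<^sub>0}" and y: "y analytic_on {z\<^sub>0}"
    and F: "\<forall>\<^sub>F z in nhds z\<^sub>0. F z = Affine (x z) (y z)"
    and eqn: "\<forall>\<^sub>F z in nhds z\<^sub>0. (y z)\<^sup>2 = poly (cubic E) (x z)"
  shows "invariant_differential_pullback E F analytic_on {z\<^sub>0}"
proof -
  define p' where "p' = (\<lambda>z. poly (pderiv (cubic E)) (x z))"
  have p': "p' analytic_on {z\<^sub>0}"
    unfolding p'_def poly_altdef by (intro analytic_intros x)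
  have x': "deriv x analytic_on {z\<^sub>0}" and y': "deriv y analytic_on {z\<^sub>0}"
    using x y by (auto intro: analytic_intros)
  have pb: "\<forall>\<^sub>F z in nhds z\<^sub>0. invariant_differential_pullback E F z =
      (if y z \<noteq> 0 then deriv x z / (2 * y z) else deriv y z / p' z)"
  proof -
    have "\<forall>\<^sub>F z in nhds z\<^sub>0. \<forall>\<^sub>F w in nhds z. F w = Affine (x w) (y w)"
      using F by (simp add: eventually_eventually)
    then show ?thesis
    proof eventually_elim
      case (elim z)
      then show ?case
        by (subst invariant_differential_pullback_cong[OF elim])
           (simp add: invariant_differential_pullback_def p'_def)
    qed
  qed
  show ?thesis
  proof (cases "y z\<^sub>0 = 0")
    case False
    have "\<forall>\<^sub>F z in nhds z\<^sub>0. invariant_differential_pullback E F z = deriv x z / (2 * y z)"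
      using pb analytic_eventually_ne[OF y False] by eventually_elim simp
    moreover have "(\<lambda>z. deriv x z / (2 * y z)) analytic_on {z\<^sub>0}"
      using False by (intro analytic_intros x' y) auto
    ultimately show ?thesis by (simp add: analytic_at_cong)
  next
    case True
    have "poly (cubic E) (x z\<^sub>0) = 0"
      using eventually_nhds_x_imp_x[OF eqn] True by simp
    then have p'0: "p' z\<^sub>0 \<noteq> 0"
      using cubic_separable[OF assms(1)] by (simp add: p'_def)
    have "\<forall>\<^sub>F z in nhds z\<^sub>0. \<forall>\<^sub>F w in nhds z. (y w)\<^sup>2 = poly (cubic E) (x w)"
      using eqn by (simp add: eventually_eventually)
    then have "\<forall>\<^sub>F z in nhds z\<^sub>0. 2 * y z * deriv y z = p' z * deriv x z"
      using eventually_analytic_nhds[OF x] eventually_analytic_nhds[OF y]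
    proof eventually_elim
      case (elim z)
      note [derivative_intros] = analytic_derivI[OF elim(2)] analytic_derivI[OF elim(3)]
      have "((\<lambda>w. (y w)\<^sup>2) has_field_derivative 2 * y z * deriv y z) (at z)"
        by (auto intro!: derivative_eq_intros)
      moreover have "((\<lambda>w. poly (cubic E) (x w)) has_field_derivative p' z * deriv x z) (at z)"
        unfolding p'_def by (rule DERIV_chain2[OF poly_DERIV]) (rule derivative_intros)
      ultimately show ?case
        using deriv_cong_ev[OF elim(1) refl] by (simp add: DERIV_imp_deriv)
    qed
    then have "\<forall>\<^sub>F z in nhds z\<^sub>0. invariant_differential_pullback E F z = deriv y z / p' z"
      using pb analytic_eventually_ne[OF p' p'0]
      by eventually_elim (auto simp: field_simps)
    moreover have "(\<lambda>z. deriv y z / p' z) analytic_on {z\<^sub>0}"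
      using p'0 by (intro analytic_intros p' y') auto
    ultimately show ?thesis by (simp add: analytic_at_cong)
  qed
qed

text \<open>The derivative by \<open>v\<close> of \<open>v - (u\<^sup>3 + a2 u\<^sup>2 v + a4 u v\<^sup>2 + a6 v\<^sup>3)\<close>, whose vanishing is the equation of the
  chart around the origin. Differentiating this equation gives \<open>dx / (2 y) = - du / omega_denominator\<close>.\<close>

definition omega_denominator :: "curve \<Rightarrow> complex \<Rightarrow> complex \<Rightarrow> complex" where
  "omega_denominator E u v =
     1 - of_rat (a2 E) * u\<^sup>2 - 2 * of_rat (a4 E) * u * v - 3 * of_rat (a6 E) * v\<^sup>2"

text \<open>At the origin itself the left-hand side is \<open>- du\<close> by definition. Elsewhere it is
  \<open>(v du - u dv) / (2 v)\<close>, and eliminating \<open>dv\<close> by the differentiated chart equation leaves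
  \<open>- du\<close> over the denominator.\<close>

lemma invariant_differential_pullback_near_origin:
  assumes u: "u analytic_on {z}" and v: "v analytic_on {z}"
    and F: "\<forall>\<^sub>F w in nhds z. F w = point_of_uv (u w) (v w)"
    and eqn: "\<forall>\<^sub>F w in nhds z. weierstrass_at_infinity E (u w) (v w)"
    and D: "omega_denominator E (u z) (v z) \<noteq> 0"
  shows "invariant_differential_pullback E F z = - deriv u z / omega_denominator E (u z) (v z)"
proof (cases "v z = 0")
  case True
  have "u z = 0"
    using eventually_nhds_x_imp_x[OF eqn] True by (simp add: weierstrass_at_infinity_def)
  moreover have "\<forall>\<^sub>F w in nhds z. u_coord (F w) = u w"
    using F eqn by eventually_elim (simp add: u_coord_point_of_uv)
  then have "deriv (\<lambda>w. u_coord (F w)) z = deriv u z"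
    by (rule deriv_cong_ev) simp
  ultimately show ?thesis
    using eventually_nhds_x_imp_x[OF F] True
    by (simp add: invariant_differential_pullback_def point_of_uv_def omega_denominator_def)
next
  case False
  define a b c :: complex where abc_def: "a = of_rat (a2 E)" "b = of_rat (a4 E)" "c = of_rat (a6 E)"
  note [derivative_intros] = analytic_derivI[OF u] analytic_derivI[OF v]
  have "\<forall>\<^sub>F w in nhds z. F w = Affine (u w / v w) (1 / v w)"
    using F analytic_eventually_ne[OF v False] by eventually_elim (simp add: point_of_uv_def)
  then have "invariant_differential_pullback E F z =
      invariant_differential_pullback E (\<lambda>w. Affine (u w / v w) (1 / v w)) z"
    by (rule invariant_differential_pullback_cong)
  also have "\<dots> = deriv (\<lambda>w. u w / v w) z / (2 * (1 / v z))"
    using False by (simp add: invariant_differential_pullback_def)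
  also have "deriv (\<lambda>w. u w / v w) z = (deriv u z * v z - u z * deriv v z) / (v z * v z)"
    using False by (intro DERIV_imp_deriv) (auto intro!: derivative_eq_intros)
  finally have pb: "invariant_differential_pullback E F z =
      (deriv u z * v z - u z * deriv v z) / (2 * v z)"
    using False by (simp add: divide_simps) (simp add: algebra_simps)
  have v_eq: "\<forall>\<^sub>F w in nhds z. v w = (u w)^3 + a * (u w)\<^sup>2 * v w + b * u w * (v w)\<^sup>2 + c * (v w)^3"
    using eqn by (simp add: weierstrass_at_infinity_def abc_def)
  have "deriv v z = deriv (\<lambda>w. (u w)^3 + a * (u w)\<^sup>2 * v w + b * u w * (v w)\<^sup>2 + c * (v w)^3) z"
    using v_eq by (rule deriv_cong_ev) simp
  also have "\<dots> = 3 * (u z)\<^sup>2 * deriv u z + a * (2 * u z * deriv u z * v z + (u z)\<^sup>2 * deriv v z)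
      + b * (deriv u z * (v z)\<^sup>2 + u z * (2 * v z * deriv v z)) + c * (3 * (v z)\<^sup>2 * deriv v z)"
    by (intro DERIV_imp_deriv) (auto intro!: derivative_eq_intros simp: algebra_simps)
  finally have dv: "deriv v z = 3 * (u z)\<^sup>2 * deriv u z
      + a * (2 * u z * deriv u z * v z + (u z)\<^sup>2 * deriv v z)
      + b * (deriv u z * (v z)\<^sup>2 + u z * (2 * v z * deriv v z)) + c * (3 * (v z)\<^sup>2 * deriv v z)" .
  have "(deriv u z * v z - u z * deriv v z) * omega_denominator E (u z) (v z) = - 2 * v z * deriv u z"
    using dv eventually_nhds_x_imp_x[OF v_eq] unfolding omega_denominator_def abc_def[symmetric]
    by algebra
  then show ?thesis
    using False D unfolding pb by (simp add: field_simps)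
qed

text \<open>A zero of order \<open>n\<close> gives a logarithmic derivative with a simple pole of residue \<open>n\<close>, so that
  \<open>L z\<^sub>0 = n\<close>.\<close>

lemma logarithmic_derivative_analytic:
  fixes u :: "complex \<Rightarrow> complex"
  assumes u: "u analytic_on {z\<^sub>0}" and "u z\<^sub>0 = 0" and nz: "\<exists>\<^sub>F z in at z\<^sub>0. u z \<noteq> 0"
  obtains L where "L analytic_on {z\<^sub>0}" "L z\<^sub>0 \<noteq> 0"
    "\<forall>\<^sub>F z in at z\<^sub>0. u z \<noteq> 0 \<and> (z - z\<^sub>0) * deriv u z = L z * u z"
proof -
  obtain r where r: "r > 0" "u holomorphic_on ball z\<^sub>0 r"
    using u by (auto simp: analytic_on_def)
  have "\<forall>\<^sub>F z in at z\<^sub>0. z \<in> ball z\<^sub>0 r"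
    using r(1) by (intro eventually_at_in_open') auto
  then obtain w where w: "w \<in> ball z\<^sub>0 r" "u w \<noteq> 0"
    using frequently_ex[OF frequently_eventually_conj[OF nz]] by blast
  obtain g s n where n: "0 < n" and s: "0 < s" "ball z\<^sub>0 s \<subseteq> ball z\<^sub>0 r"
    and g: "g holomorphic_on ball z\<^sub>0 s"
      "\<And>z. z \<in> ball z\<^sub>0 s \<Longrightarrow> u z = (z - z\<^sub>0) ^ n * g z" "\<And>z. z \<in> ball z\<^sub>0 s \<Longrightarrow> g z \<noteq> 0"
    using holomorphic_factor_zero_nonconstant[OF r(2) open_ball connected_ball, of z\<^sub>0]
      r(1) assms(2) w unfolding constant_on_def by (metis centre_in_ball)
  define L where "L = (\<lambda>z. of_nat n + (z - z\<^sub>0) * deriv g z / g z)"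
  have ga: "g analytic_on {z\<^sub>0}"
    using g(1) s(1) by (auto intro: holomorphic_on_imp_analytic_at)
  have "L analytic_on {z\<^sub>0}"
    unfolding L_def using g(3) s(1) ga by (intro analytic_intros) auto
  moreover have "L z\<^sub>0 \<noteq> 0"
    using n by (simp add: L_def)
  moreover have "\<forall>\<^sub>F z in at z\<^sub>0. z \<in> ball z\<^sub>0 s - {z\<^sub>0}"
    using s(1) by (intro eventually_at_in_open) auto
  then have "\<forall>\<^sub>F z in at z\<^sub>0. u z \<noteq> 0 \<and> (z - z\<^sub>0) * deriv u z = L z * u z"
  proof eventually_elim
    case (elim z)
    have "g analytic_on {z}"
      using elim g(1) by (auto simp: analytic_at)
    note [derivative_intros] = analytic_derivI[OF this]
    have "\<forall>\<^sub>F w in nhds z. u w = (w - z\<^sub>0) ^ n * g w"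
      using elim g(2) by (intro eventually_nhds_in_open[THEN eventually_mono, of "ball z\<^sub>0 s"]) auto
    then have "deriv u z = deriv (\<lambda>w. (w - z\<^sub>0) ^ n * g w) z"
      by (rule deriv_cong_ev) simp
    also have "\<dots> = of_nat n * (z - z\<^sub>0) ^ (n - 1) * g z + (z - z\<^sub>0) ^ n * deriv g z"
      by (intro DERIV_imp_deriv) (auto intro!: derivative_eq_intros simp: algebra_simps)
    finally have "(z - z\<^sub>0) * deriv u z =
        of_nat n * ((z - z\<^sub>0) * (z - z\<^sub>0) ^ (n - 1)) * g z + (z - z\<^sub>0) ^ n * ((z - z\<^sub>0) * deriv g z)"
      by (simp add: algebra_simps)
    also have "(z - z\<^sub>0) * (z - z\<^sub>0) ^ (n - 1) = (z - z\<^sub>0) ^ n"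
      using n by (simp flip: power_Suc)
    finally show ?case
      using elim g(2,3)[of z] by (simp add: L_def distrib_right)
  qed
  ultimately show ?thesis using that by blast
qed

text \<open>The local form of the statement that \<open>x (dx / 2y)\<^sup>2\<close> has a double pole at the origin and no
  other pole. In the chart at the origin, \<open>v\<close> is \<open>u\<^sup>3 / W\<close> with \<open>W\<close> a unit, so \<open>x = u / v\<close> is
  \<open>W / u\<^sup>2\<close>; together with \<open>\<omega> = - u' / D\<close> the product \<open>x \<omega>\<^sup>2\<close> becomes \<open>(u' / u)\<^sup>2\<close> times a unit.
  Since \<open>u' / u\<close> has a simple pole for every order of vanishing of \<open>u\<close>, ramification is harmless.\<close>

lemma x_times_differential_squared:
  assumes E: "elliptic_curve E" and F: "curve_analytic_at E F z\<^sub>0"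
  obtains G where "G analytic_on {z\<^sub>0}"
    "\<forall>\<^sub>F z in at z\<^sub>0. x_coord (F z) * ((z - z\<^sub>0) * invariant_differential_pullback E F z)\<^sup>2 = G z"
    "F z\<^sub>0 = Origin \<Longrightarrow> \<exists>\<^sub>F z in at z\<^sub>0. invariant_differential_pullback E F z \<noteq> 0 \<Longrightarrow> G z\<^sub>0 \<noteq> 0"
  using F
proof (cases rule: curve_analytic_at_cases)
  case (affine x y)
  have "F z\<^sub>0 \<noteq> Origin"
    using eventually_nhds_x_imp_x[OF affine(3)] by simp
  moreover have "\<forall>\<^sub>F z in nhds z\<^sub>0. x_coord (F z) * ((z - z\<^sub>0) * invariant_differential_pullback E F z)\<^sup>2
      = x z * ((z - z\<^sub>0) * invariant_differential_pullback E F z)\<^sup>2"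
    using affine(3) by eventually_elim simp
  moreover have "(\<lambda>z. x z * ((z - z\<^sub>0) * invariant_differential_pullback E F z)\<^sup>2) analytic_on {z\<^sub>0}"
    by (intro analytic_intros affine(1)
        invariant_differential_pullback_affine_analytic[OF E affine])
  ultimately show ?thesis
    using that by (simp add: eventually_nhds_conv_at)
next
  case (origin u v)
  define a b c :: complex where abc_def: "a = of_rat (a2 E)" "b = of_rat (a4 E)" "c = of_rat (a6 E)"
  define W where "W = (\<lambda>z. 1 - a * (u z)\<^sup>2 - b * u z * v z - c * (v z)\<^sup>2)"
  define D where "D = (\<lambda>z. omega_denominator E (u z) (v z))"
  have W: "W analytic_on {z\<^sub>0}" and D: "D analytic_on {z\<^sub>0}"
    unfolding W_def D_def omega_denominator_def by (intro analytic_intros origin(1,2))+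
  have W0: "W z\<^sub>0 = 1" and D0: "D z\<^sub>0 = 1"
    using origin(3,4) by (auto simp: W_def D_def omega_denominator_def)
  have Dnz: "\<forall>\<^sub>F z in nhds z\<^sub>0. D z \<noteq> 0"
    using D0 by (intro analytic_eventually_ne[OF D]) auto
  have "\<forall>\<^sub>F z in nhds z\<^sub>0. \<forall>\<^sub>F w in nhds z. F w = point_of_uv (u w) (v w)"
    "\<forall>\<^sub>F z in nhds z\<^sub>0. \<forall>\<^sub>F w in nhds z. weierstrass_at_infinity E (u w) (v w)"
    using origin(5,6) by (simp_all add: eventually_eventually)
  then have pb: "\<forall>\<^sub>F z in nhds z\<^sub>0. invariant_differential_pullback E F z = - deriv u z / D z"
    using eventually_analytic_nhds[OF origin(1)] eventually_analytic_nhds[OF origin(2)] Dnz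
    unfolding D_def by eventually_elim (rule invariant_differential_pullback_near_origin)
  have xW: "\<forall>\<^sub>F z in nhds z\<^sub>0. x_coord (F z) * (u z)\<^sup>2 = (if u z = 0 then 0 else W z)"
    using origin(5,6)
  proof eventually_elim
    case (elim z)
    have vW: "v z * W z = (u z)^3"
      using elim(2) unfolding weierstrass_at_infinity_def abc_def[symmetric] W_def by algebra
    show ?case
    proof (cases "v z = 0")
      case True
      then show ?thesis using vW elim(1) by (simp add: point_of_uv_def)
    next
      case False
      then have "u z / v z * (u z)\<^sup>2 = W z"
        using vW by (simp add: field_simps power2_eq_square power3_eq_cube)
      then show ?thesis
        using False elim(1) by (auto simp: point_of_uv_def)
    qed
  qed
  show ?thesis
  proof (cases "\<exists>\<^sub>F z in at z\<^sub>0. u z \<noteq> 0")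
    case True
    then obtain L where L: "L analytic_on {z\<^sub>0}" "L z\<^sub>0 \<noteq> 0"
      "\<forall>\<^sub>F z in at z\<^sub>0. u z \<noteq> 0 \<and> (z - z\<^sub>0) * deriv u z = L z * u z"
      using logarithmic_derivative_analytic[OF origin(1,3)] by blast
    show ?thesis
    proof (rule that)
      show "(\<lambda>z. W z * (L z / D z)\<^sup>2) analytic_on {z\<^sub>0}"
        using D0 by (intro analytic_intros W D L) auto
      have "\<forall>\<^sub>F z in at z\<^sub>0. invariant_differential_pullback E F z = - deriv u z / D z"
        "\<forall>\<^sub>F z in at z\<^sub>0. x_coord (F z) * (u z)\<^sup>2 = (if u z = 0 then 0 else W z)"
        using pb xW by (simp_all add: eventually_nhds_conv_at)
      then show "\<forall>\<^sub>F z in at z\<^sub>0.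
          x_coord (F z) * ((z - z\<^sub>0) * invariant_differential_pullback E F z)\<^sup>2 = W z * (L z / D z)\<^sup>2"
        using L(3)
      proof eventually_elim
        case (elim z)
        have "(z - z\<^sub>0) * invariant_differential_pullback E F z = - (L z * u z) / D z"
          using elim by simp
        then have "x_coord (F z) * ((z - z\<^sub>0) * invariant_differential_pullback E F z)\<^sup>2 =
            (x_coord (F z) * (u z)\<^sup>2) * (L z / D z)\<^sup>2"
          by (simp only: power_mult_distrib power_divide power2_minus minus_divide_left) simp
        then show ?case using elim by simp
      qed
      show "W z\<^sub>0 * (L z\<^sub>0 / D z\<^sub>0)\<^sup>2 \<noteq> 0"
        using W0 D0 L(2) by simp
    qed
  next
    case False
    then have "\<forall>\<^sub>F z in nhds z\<^sub>0. u z = 0"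
      using origin(3) by (simp add: frequently_def eventually_nhds_conv_at)
    then have "\<forall>\<^sub>F z in nhds z\<^sub>0. \<forall>\<^sub>F w in nhds z. u w = 0"
      by (simp add: eventually_eventually)
    then have "\<forall>\<^sub>F z in nhds z\<^sub>0. deriv u z = 0"
    proof eventually_elim
      case (elim z)
      then have "deriv u z = deriv (\<lambda>_. 0) z"
        by (rule deriv_cong_ev) simp
      then show ?case by simp
    qed
    then have 0: "\<forall>\<^sub>F z in nhds z\<^sub>0. invariant_differential_pullback E F z = 0"
      using pb by eventually_elim simp
    show ?thesis
    proof (rule that[of "\<lambda>_. 0"])
      show "\<forall>\<^sub>F z in at z\<^sub>0.
          x_coord (F z) * ((z - z\<^sub>0) * invariant_differential_pullback E F z)\<^sup>2 = 0"
        using 0 by (auto simp: eventually_nhds_conv_at elim: eventually_mono)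
      show "(0::complex) \<noteq> 0" if "\<exists>\<^sub>F z in at z\<^sub>0. invariant_differential_pullback E F z \<noteq> 0"
        using that 0 by (simp add: frequently_def eventually_nhds_conv_at)
    qed auto
  qed
qed

lemma x_coord_analytic:
  assumes F: "curve_analytic_at E F z\<^sub>0" "F z\<^sub>0 \<noteq> Origin"
  shows "(\<lambda>z. x_coord (F z)) analytic_on {z\<^sub>0}"
  using F(1)
proof (cases rule: curve_analytic_at_cases)
  case (affine x y)
  have "\<forall>\<^sub>F z in nhds z\<^sub>0. x_coord (F z) = x z"
    using affine(3) by eventually_elim simp
  then show ?thesis using affine(1) by (simp add: analytic_at_cong)
next
  case (origin u v)
  then show ?thesis
    using eventually_nhds_x_imp_x[OF origin(5)] F(2) by (simp add: point_of_uv_def)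
qed

text \<open>If \<open>F\<close> is ramified of order \<open>e\<close> at \<open>z\<^sub>0\<close>, then \<open>x\<close> has a pole of order \<open>2 e\<close> and \<open>\<omega>\<close> a zero
  of order \<open>e - 1\<close>, which leaves a double pole.\<close>

lemma is_pole_x_differential_squared:
  assumes E: "elliptic_curve E" and F: "curve_analytic_at E F z\<^sub>0" "F z\<^sub>0 = Origin"
    and nz: "\<exists>\<^sub>F z in at z\<^sub>0. invariant_differential_pullback E F z \<noteq> 0"
  shows "is_pole (\<lambda>z. x_coord (F z) * (invariant_differential_pullback E F z)\<^sup>2) z\<^sub>0"
    and "isolated_singularity_at (\<lambda>z. x_coord (F z) * (invariant_differential_pullback E F z)\<^sup>2) z\<^sub>0"
proof -
  let ?\<omega> = "invariant_differential_pullback E F"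
  obtain G where G: "G analytic_on {z\<^sub>0}" "G z\<^sub>0 \<noteq> 0"
    and eq: "\<forall>\<^sub>F z in at z\<^sub>0. x_coord (F z) * ((z - z\<^sub>0) * ?\<omega> z)\<^sup>2 = G z"
    using x_times_differential_squared[OF E F(1)] F(2) nz by metis
  have ev: "\<forall>\<^sub>F z in at z\<^sub>0. x_coord (F z) * (?\<omega> z)\<^sup>2 = G z / (z - z\<^sub>0) ^ 2"
    using eq eventually_neq_at_within[of z\<^sub>0 z\<^sub>0 UNIV]
    by eventually_elim (simp add: eq_divide_eq power_mult_distrib mult_ac)
  have "is_pole (\<lambda>z. G z / (z - z\<^sub>0) ^ 2) z\<^sub>0"
    using analytic_at_imp_isCont[OF G(1)] G(2)
    by (intro is_pole_divide) (auto intro!: tendsto_eq_intros simp: filterlim_at eventually_at_filter)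
  then show "is_pole (\<lambda>z. x_coord (F z) * (?\<omega> z)\<^sup>2) z\<^sub>0"
    using is_pole_cong[OF ev refl] by simp
  have "isolated_singularity_at (\<lambda>z. G z / (z - z\<^sub>0) ^ 2) z\<^sub>0"
    by (intro singularity_intros isolated_singularity_at_analytic not_essential_analytic analytic_intros G)
  then show "isolated_singularity_at (\<lambda>z. x_coord (F z) * (?\<omega> z)\<^sup>2) z\<^sub>0"
    using isolated_singularity_at_cong[OF ev refl] by simp
qed

section \<open>Local parameters of the modular curve\<close>

lemma open_upper_half: "open upper_half"
  by (simp add: upper_half_def open_halfspace_Im_gt)

lemma moebius_denominator_nonzero:
  assumes "A \<in> SL2Z" "\<tau> \<in> upper_half"
  shows "of_int (A$2$1) * \<tau> + of_int (A$2$2) \<noteq> 0"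
proof
  assume 0: "of_int (A$2$1) * \<tau> + of_int (A$2$2) = 0"
  then have "Im (of_int (A$2$1) * \<tau> + of_int (A$2$2)) = 0" by simp
  then have "A$2$1 = 0" using assms(2) by (simp add: upper_half_def)
  moreover from this have "A$2$2 = 0" using 0 by simp
  ultimately show False using assms(1) by (simp add: SL2Z_def det_2)
qed

lemma moebius_has_field_derivative:
  assumes "A \<in> SL2Z" "\<tau> \<in> upper_half"
  shows "(moebius A has_field_derivative 1 / (of_int (A$2$1) * \<tau> + of_int (A$2$2))\<^sup>2) (at \<tau>)"
proof -
  have "A$1$1 * A$2$2 - A$1$2 * A$2$1 = 1"
    using assms(1) by (simp add: SL2Z_def det_2)
  then have "of_int (A$1$1 * A$2$2 - A$1$2 * A$2$1) = (1::complex)" by simp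
  then have "of_int (A$1$1) * of_int (A$2$2) - of_int (A$1$2) * of_int (A$2$1) = (1::complex)"
    by simp
  then have *: "of_int (A$1$1) * (of_int (A$2$1) * \<tau> + of_int (A$2$2))
      - (of_int (A$1$1) * \<tau> + of_int (A$1$2)) * of_int (A$2$1) = (1::complex)"
    by (simp add: algebra_simps)
  show ?thesis
    unfolding moebius_def
    using moebius_denominator_nonzero[OF assms] *
    by (auto intro!: derivative_eq_intros simp: power2_eq_square)
qed

lemma moebius_in_upper_half:
  assumes "A \<in> SL2Z" "\<tau> \<in> upper_half"
  shows "moebius A \<tau> \<in> upper_half"
proof -
  define w where "w = of_int (A$2$1) * \<tau> + of_int (A$2$2)"
  have w: "(Re w)\<^sup>2 + (Im w)\<^sup>2 > 0"
    using moebius_denominator_nonzero[OF assms] by (simp add: w_def sum_power2_gt_zero_iff complex_eq_iff)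
  have "real_of_int (A$1$1 * A$2$2 - A$1$2 * A$2$1) = 1"
    using assms(1) by (simp only: SL2Z_def det_2 mem_Collect_eq of_int_1)
  then have det: "real_of_int (A$1$1) * real_of_int (A$2$2) - real_of_int (A$1$2) * real_of_int (A$2$1) = 1"
    by simp
  have "Im (moebius A \<tau>) =
      (Im (of_int (A$1$1) * \<tau> + of_int (A$1$2)) * Re w - Re (of_int (A$1$1) * \<tau> + of_int (A$1$2)) * Im w)
        / ((Re w)\<^sup>2 + (Im w)\<^sup>2)"
    unfolding moebius_def w_def[symmetric] by (rule Im_divide)
  also have "Im (of_int (A$1$1) * \<tau> + of_int (A$1$2)) * Re w - Re (of_int (A$1$1) * \<tau> + of_int (A$1$2)) * Im w =
      (real_of_int (A$1$1) * real_of_int (A$2$2) - real_of_int (A$1$2) * real_of_int (A$2$1)) * Im \<tau>"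
    by (simp add: w_def algebra_simps)
  finally show ?thesis
    using assms(2) w unfolding det by (simp add: upper_half_def)
qed

lemma moebius_analytic:
  assumes "A \<in> SL2Z" "\<tau> \<in> upper_half"
  shows "moebius A analytic_on {\<tau>}"
  unfolding moebius_def
  using moebius_denominator_nonzero[OF assms] by (intro analytic_intros) auto

lemma moebius_ext_cusp_points:
  assumes "p \<in> cusp_points"
  shows "moebius_ext A p \<in> cusp_points"
  using assms by (cases p) (auto simp: cusp_points_def moebius_def)

text \<open>Integer matrices preserve \<open>\<rat> \<union> {\<infinity>}\<close>, so the orbit of a point of the upper half plane
  is never that of a cusp.\<close>

lemma orbit_upper_half_not_cusp:
  assumes "\<tau> \<in> upper_half" "mat 1 \<in> \<Gamma>"
  shows "orbit \<Gamma> (Some \<tau>) \<notin> cusps \<Gamma>"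
proof
  assume "orbit \<Gamma> (Some \<tau>) \<in> cusps \<Gamma>"
  then obtain p where p: "p \<in> cusp_points" "orbit \<Gamma> (Some \<tau>) = orbit \<Gamma> p"
    by (auto simp: cusps_def)
  have "moebius_ext (mat 1) (Some \<tau>) = Some \<tau>"
    by (simp add: moebius_def mat_def)
  then have "Some \<tau> \<in> orbit \<Gamma> (Some \<tau>)"
    using assms(2) unfolding orbit_def by (metis image_eqI)
  then have "Some \<tau> \<in> cusp_points"
    unfolding p(2) using p(1) moebius_ext_cusp_points unfolding orbit_def by (metis imageE)
  moreover have "\<tau> \<notin> \<rat>"
    using assms(1) by (auto simp: upper_half_def elim!: Rats_cases')
  ultimately show False by (auto simp: cusp_points_def)
qed

lemma elliptic_param_analytic:
  assumes "\<tau>\<^sub>0 \<in> upper_half"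
  shows "elliptic_param \<Gamma> \<tau>\<^sub>0 analytic_on {\<tau>\<^sub>0}"
proof -
  have "\<tau>\<^sub>0 - cnj \<tau>\<^sub>0 \<noteq> 0"
    using assms by (auto simp: upper_half_def complex_eq_iff)
  then show ?thesis
    unfolding elliptic_param_def by (intro analytic_intros) auto
qed

lemma curve_analytic_at_lift:
  assumes "holomorphic_map \<Gamma> E \<Phi>" "\<tau>\<^sub>0 \<in> upper_half"
  shows "curve_analytic_at E (lift \<Gamma> \<Phi>) \<tau>\<^sub>0"
proof -
  obtain F where F: "curve_analytic_at E F 0"
    and eq: "\<forall>\<^sub>F \<tau> in nhds \<tau>\<^sub>0. lift \<Gamma> \<Phi> \<tau> = F (elliptic_param \<Gamma> \<tau>\<^sub>0 \<tau>)"
    using assms unfolding holomorphic_map_def by blast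
  have "curve_analytic_at E (\<lambda>\<tau>. F (elliptic_param \<Gamma> \<tau>\<^sub>0 \<tau>)) \<tau>\<^sub>0"
  (* An order of 0 makes the local parameter constantly 1. Then the map is locally constant,
     and its value lies on the curve. *)
  proof (cases "elliptic_order \<Gamma> \<tau>\<^sub>0 = 0")
    case True
    have "on_curve E (lift \<Gamma> \<Phi> \<tau>\<^sub>0)"
      using assms by (auto simp: holomorphic_map_def complex_points_def modular_curve_def)
    then have "on_curve E (F 1)"
      using eventually_nhds_x_imp_x[OF eq] True by (simp add: elliptic_param_def)
    then show ?thesis
      using True by (simp add: elliptic_param_def curve_analytic_at_const)
  next
    case False
    then have "elliptic_param \<Gamma> \<tau>\<^sub>0 \<tau>\<^sub>0 = 0"
      by (simp add: elliptic_param_def)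
    then show ?thesis
      using curve_analytic_at_compose[where m = "elliptic_param \<Gamma> \<tau>\<^sub>0" and F = F and t = \<tau>\<^sub>0]
        F elliptic_param_analytic[OF assms(2)] by simp
  qed
  then show ?thesis
    using curve_analytic_at_cong[OF eq] by simp
qed

text \<open>The matrix \<open>\<alpha> T\<^sup>M \<alpha>\<^sup>-\<^sup>1 = 1 + M (\<alpha> E\<^sub>1\<^sub>2 \<alpha>\<^sup>-\<^sup>1)\<close>, with \<open>E\<^sub>1\<^sub>2\<close> the elementary matrix, has
  off-diagonal entries divisible by \<open>M\<close>. Hence the set whose least element is the width is not
  empty.\<close>

lemma cusp_width_pos:
  assumes \<alpha>: "\<alpha> \<in> SL2Z" and M: "M > 0"
    and \<Gamma>: "\<And>A. \<lbrakk>A \<in> SL2Z; int M dvd A$1$2; int M dvd A$2$1\<rbrakk> \<Longrightarrow> A \<in> \<Gamma>"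
  shows "cusp_width \<Gamma> \<alpha> > 0"
proof -
  define a b c d where abcd: "a = \<alpha>$1$1" "b = \<alpha>$1$2" "c = \<alpha>$2$1" "d = \<alpha>$2$2"
  have det: "a * d - b * c = 1"
    using \<alpha> by (simp add: SL2Z_def det_2 abcd)
  define A :: "int^2^2" where
    "A = vector [vector [1 - int M * a * c, int M * a\<^sup>2], vector [- int M * c\<^sup>2, 1 + int M * a * c]]"
  have "A \<in> \<Gamma>"
    by (rule \<Gamma>) (auto simp: A_def SL2Z_def det_2 vector_2 algebra_simps power2_eq_square)
  moreover have "(1 - int M * a * c) * b + int M * a\<^sup>2 * d = a * int M + b"
    "- int M * c\<^sup>2 * b + (1 + int M * a * c) * d = c * int M + d"
    using arg_cong[OF det, of "\<lambda>t. int M * a * t + b"] arg_cong[OF det, of "\<lambda>t. int M * c * t + d"]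
    by (simp_all add: algebra_simps power2_eq_square)
  then have "A ** \<alpha> = \<alpha> ** translation M"
    by (simp add: vec_eq_iff forall_2 matrix_matrix_mult_def sum_2 A_def translation_def vector_2
        abcd[symmetric] power2_eq_square algebra_simps)
  ultimately have "M > 0 \<and> (\<exists>A \<in> pm \<Gamma>. A ** \<alpha> = \<alpha> ** translation M)"
    using M by (auto simp: pm_def)
  then show ?thesis
    unfolding cusp_width_def by (rule LeastI2) auto
qed

lemma cusp_width_Gamma_k_pos:
  assumes "\<alpha> \<in> SL2Z" "k \<ge> 2" "N \<ge> 1"
  shows "cusp_width (Gamma_k N k) \<alpha> > 0"
  by (rule cusp_width_pos[OF assms(1), of "k div 2 * N"])
     (use assms in \<open>auto simp: Gamma_k_def Gamma0_def Gamma_upper0_def dvd_mult_left\<close>)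

lemma cusp_param_at_i_infinity:
  assumes "cusp_width \<Gamma> \<alpha> > 0"
  shows "filterlim (cusp_param \<Gamma> \<alpha>) (at 0) at_i_infinity"
proof -
  have "- (2 * pi / cusp_width \<Gamma> \<alpha>) < 0"
    using assms by simp
  then have "filterlim (\<lambda>y. - (2 * pi / cusp_width \<Gamma> \<alpha>) * y) at_bot at_top"
    by (intro filterlim_tendsto_neg_mult_at_bot[OF tendsto_const] filterlim_ident)
  then have "((\<lambda>y. exp (- (2 * pi / cusp_width \<Gamma> \<alpha>) * y)) \<longlongrightarrow> 0) at_top"
    by (rule filterlim_compose[OF exp_at_bot])
  then have "((\<lambda>\<tau>. exp (- (2 * pi / cusp_width \<Gamma> \<alpha>) * Im \<tau>)) \<longlongrightarrow> 0) at_i_infinity"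
    by (rule filterlim_compose[OF _ filterlim_filtercomap])
  moreover have "norm (cusp_param \<Gamma> \<alpha> \<tau>) = exp (- (2 * pi / cusp_width \<Gamma> \<alpha>) * Im \<tau>)" for \<tau>
    by (simp add: cusp_param_def norm_exp_eq_Re)
  ultimately have "((\<lambda>\<tau>. norm (cusp_param \<Gamma> \<alpha> \<tau>)) \<longlongrightarrow> 0) at_i_infinity"
    by simp
  then have "(cusp_param \<Gamma> \<alpha> \<longlongrightarrow> 0) at_i_infinity"
    by (rule tendsto_norm_zero_cancel)
  then show ?thesis
    by (simp add: filterlim_at cusp_param_def)
qed

lemma eventually_at_i_infinity_nhds:
  assumes "eventually P at_i_infinity"
  shows "\<forall>\<^sub>F \<tau> in at_i_infinity. \<forall>\<^sub>F t in nhds \<tau>. P t"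
proof -
  obtain c where c: "\<And>\<tau>. c < Im \<tau> \<Longrightarrow> P \<tau>"
    using assms by (auto simp: eventually_filtercomap_at_top_dense)
  have "\<forall>\<^sub>F t in nhds \<tau>. P t" if "c < Im \<tau>" for \<tau>
    using that c by (auto intro!: eventually_nhds_in_open[THEN eventually_mono, of "{\<tau>. c < Im \<tau>}"]
        simp: open_halfspace_Im_gt)
  then show ?thesis
    by (auto simp: eventually_filtercomap_at_top_dense)
qed

lemma eventually_at_i_infinity_upper_half: "\<forall>\<^sub>F \<tau> in at_i_infinity. \<tau> \<in> upper_half"
  by (auto simp: eventually_filtercomap_at_top_dense upper_half_def)

section \<open>Behaviour at the cusps\<close>

lemma cusp_expansion_cong:
  assumes "\<And>\<tau>. \<tau> \<in> upper_half \<Longrightarrow> f \<tau> = g \<tau>" "\<alpha> \<in> SL2Z"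
  shows "cusp_expansion w \<Gamma> f \<alpha> G \<longleftrightarrow> cusp_expansion w \<Gamma> g \<alpha> G"
proof -
  have "\<forall>\<^sub>F \<tau> in at_i_infinity. slash w f \<alpha> \<tau> = slash w g \<alpha> \<tau>"
    using eventually_at_i_infinity_upper_half
    by eventually_elim (simp add: slash_def assms moebius_in_upper_half)
  then have "(\<forall>\<^sub>F \<tau> in at_i_infinity. slash w f \<alpha> \<tau> = G (cusp_param \<Gamma> \<alpha> \<tau>)) \<longleftrightarrow>
      (\<forall>\<^sub>F \<tau> in at_i_infinity. slash w g \<alpha> \<tau> = G (cusp_param \<Gamma> \<alpha> \<tau>))"
    by (rule eventually_cong) simp
  then show ?thesis by (simp add: cusp_expansion_def)
qed

text \<open>Near the cusp \<open>\<phi> \<circ> \<alpha>\<close> equals \<open>F \<circ> q\<close>. The chain rule applied to both sides turns the factor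
  \<open>(c \<tau> + d)\<^sup>-\<^sup>4\<close> of the weight-4 slash into \<open>(d\<alpha>/d\<tau>)\<^sup>2\<close>, and yields \<open>C\<^sup>2 x (F q) (q \<omega>\<^sub>F q)\<^sup>2\<close>
  with \<open>C = 2 \<pi> i / h\<close>, since \<open>dq/d\<tau> = C q\<close>. The extra factor \<open>q\<^sup>2\<close> compensates exactly the
  double pole that can occur if the cusp is mapped to the origin.\<close>

lemma cusp_expansion_x_differential_squared:
  fixes \<Gamma> \<Phi>
  defines "\<phi> \<equiv> lift \<Gamma> \<Phi>"
  assumes E: "elliptic_curve E" and \<Phi>: "holomorphic_map \<Gamma> E \<Phi>"
    and \<alpha>: "\<alpha> \<in> SL2Z" and h: "cusp_width \<Gamma> \<alpha> > 0"
  obtains G where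
    "cusp_expansion 4 \<Gamma> (\<lambda>\<tau>. x_coord (\<phi> \<tau>) * (invariant_differential_pullback E \<phi> \<tau>)\<^sup>2) \<alpha> G"
proof -
  define q where "q = cusp_param \<Gamma> \<alpha>"
  define C where "C = 2 * of_real pi * \<i> / of_nat (cusp_width \<Gamma> \<alpha>)"
  let ?\<omega> = "invariant_differential_pullback E"
  obtain F where F: "curve_analytic_at E F 0"
    and eq: "\<forall>\<^sub>F \<tau> in at_i_infinity. \<phi> (moebius \<alpha> \<tau>) = F (q \<tau>)"
    using \<Phi> \<alpha> unfolding holomorphic_map_def \<phi>_def q_def by blast
  obtain G where G: "G analytic_on {0}"
    and FG: "\<forall>\<^sub>F z in at 0. x_coord (F z) * ((z - 0) * ?\<omega> F z)\<^sup>2 = G z"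
    using x_times_differential_squared[OF E F] by metis
  have q: "q analytic_on {\<tau>}" "deriv q \<tau> = C * q \<tau>" for \<tau>
  proof -
    show "q analytic_on {\<tau>}"
      unfolding q_def cusp_param_def using h by (intro analytic_intros) auto
    show "deriv q \<tau> = C * q \<tau>"
      unfolding q_def cusp_param_def C_def using h
      by (intro DERIV_imp_deriv) (auto intro!: derivative_eq_intros)
  qed
  have lim: "filterlim q (at 0) at_i_infinity"
    unfolding q_def by (rule cusp_param_at_i_infinity[OF h])
  have "\<forall>\<^sub>F z in at 0. curve_analytic_at E F z"
    using eventually_curve_analytic_at[OF F] by (simp add: eventually_nhds_conv_at)
  then have Fq: "\<forall>\<^sub>F \<tau> in at_i_infinity. curve_analytic_at E F (q \<tau>)"
    using lim by (rule eventually_compose_filterlim)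
  have FGq: "\<forall>\<^sub>F \<tau> in at_i_infinity. x_coord (F (q \<tau>)) * (q \<tau> * ?\<omega> F (q \<tau>))\<^sup>2 = G (q \<tau>)"
    using eventually_compose_filterlim[OF FG lim] by simp
  have "\<forall>\<^sub>F \<tau> in at_i_infinity.
      slash 4 (\<lambda>\<tau>. x_coord (\<phi> \<tau>) * (?\<omega> \<phi> \<tau>)\<^sup>2) \<alpha> \<tau> = C\<^sup>2 * G (q \<tau>)"
    using eventually_at_i_infinity_nhds[OF eq] eventually_at_i_infinity_upper_half Fq FGq
  proof eventually_elim
    case (elim \<tau>)
    define w where "w = of_int (\<alpha>$2$1) * \<tau> + of_int (\<alpha>$2$2)"
    have w: "w \<noteq> 0"
      using moebius_denominator_nonzero[OF \<alpha> elim(2)] by (simp add: w_def)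
    have "?\<omega> \<phi> (moebius \<alpha> \<tau>) / w\<^sup>2 = ?\<omega> \<phi> (moebius \<alpha> \<tau>) * deriv (moebius \<alpha>) \<tau>"
      using DERIV_imp_deriv[OF moebius_has_field_derivative[OF \<alpha> elim(2)]] by (simp add: w_def)
    also have "\<dots> = ?\<omega> (\<lambda>t. \<phi> (moebius \<alpha> t)) \<tau>"
      using curve_analytic_at_lift[OF \<Phi> moebius_in_upper_half[OF \<alpha> elim(2)]] moebius_analytic[OF \<alpha> elim(2)]
      unfolding \<phi>_def by (rule invariant_differential_pullback_compose[symmetric])
    also have "\<dots> = ?\<omega> (\<lambda>t. F (q t)) \<tau>"
      using elim(1) by (rule invariant_differential_pullback_cong)
    also have "\<dots> = ?\<omega> F (q \<tau>) * (C * q \<tau>)"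
      using invariant_differential_pullback_compose[where m = q, OF elim(3) q(1)] q(2) by simp
    finally have 1: "?\<omega> \<phi> (moebius \<alpha> \<tau>) / w\<^sup>2 = C * (q \<tau> * ?\<omega> F (q \<tau>))"
      by (simp add: mult_ac)
    have "slash 4 (\<lambda>\<tau>. x_coord (\<phi> \<tau>) * (?\<omega> \<phi> \<tau>)\<^sup>2) \<alpha> \<tau> =
        x_coord (\<phi> (moebius \<alpha> \<tau>)) * (?\<omega> \<phi> (moebius \<alpha> \<tau>) / w\<^sup>2)\<^sup>2"
      by (simp add: slash_def w_def power_divide flip: power_mult)
    also have "\<dots> = C\<^sup>2 * (x_coord (F (q \<tau>)) * (q \<tau> * ?\<omega> F (q \<tau>))\<^sup>2)"
      unfolding 1 using eventually_nhds_x_imp_x[OF elim(1)] by (simp add: power_mult_distrib)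
    finally show ?case
      by (simp only: elim(4))
  qed
  moreover have "(\<lambda>z. C\<^sup>2 * G z) analytic_on {0}"
    by (intro analytic_intros G)
  ultimately show ?thesis
    using that[of "\<lambda>z. C\<^sup>2 * G z"] by (simp add: cusp_expansion_def q_def)
qed

section \<open>Non-vanishing\<close>

text \<open>Every \<open>q\<close> in the punctured unit disc is some \<open>exp (2 \<pi> i \<tau>)\<close>, so this is uniqueness of power series
  coefficients.\<close>

lemma fourier_coeffs_nonzero:
  assumes a: "fourier_coeffs f a" and "a m \<noteq> 0"
  shows "\<exists>\<tau>\<in>upper_half. f \<tau> \<noteq> 0"
proof (rule ccontr)
  assume "\<not> ?thesis"
  then have f0: "f \<tau> = 0" if "\<tau> \<in> upper_half" for \<tau>
    using that by blast
  (* Shifting the coefficients by one makes the power series vanish at q = 0 as well, where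
     the hypothesis says nothing about its value. *)
  define b where "b n = (case n of 0 \<Rightarrow> 0 | Suc n \<Rightarrow> a n)" for n
  have sums: "(\<lambda>n. b n * (q - 0) ^ n) sums 0" if "norm (q - 0) < 1" for q
  proof (cases "q = 0")
    case True
    have "(\<lambda>n. b n * (q - 0) ^ n) = (\<lambda>_. 0)"
      using True by (auto simp: b_def split: nat.split)
    then show ?thesis by simp
  next
    case False
    define \<tau> where "\<tau> = Ln q / (2 * of_real pi * \<i>)"
    have q: "exp (2 * of_real pi * \<i> * \<tau>) = q"
      using False by (simp add: \<tau>_def)
    have "exp (- 2 * pi * Im \<tau>) < 1"
      using that q[symmetric] by (simp add: norm_exp_eq_Re)
    then have "\<tau> \<in> upper_half"
      by (simp add: upper_half_def zero_less_mult_iff)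
    then have "(\<lambda>n. a n * exp (2 * of_real pi * \<i> * of_nat n * \<tau>)) sums 0"
      using a f0 by (force simp: fourier_coeffs_def)
    moreover have "exp (2 * of_real pi * \<i> * of_nat n * \<tau>) = q ^ n" for n
      by (simp add: q[symmetric] exp_of_nat_mult[symmetric] mult_ac)
    ultimately have "(\<lambda>n. q * (a n * q ^ n)) sums (q * 0)"
      by (intro sums_mult) simp
    then have "(\<lambda>n. b (Suc n) * q ^ Suc n) sums 0"
      by (simp add: b_def mult_ac)
    then show ?thesis
      using sums_Suc_iff[of "\<lambda>n. b n * q ^ n" 0] by (simp add: b_def)
  qed
  obtain s where "s > 0" "\<And>z. z \<in> cball (0::complex) s - {0} \<Longrightarrow> (0::complex) \<noteq> 0"
    using powser_0_nonzero[of 1 0 b "\<lambda>_. 0" "Suc m"] sums assms(2) by (auto simp: b_def)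
  moreover have "complex_of_real s \<in> cball 0 s - {0}"
    using \<open>s > 0\<close> by simp
  ultimately show False by blast
qed

lemma newform_eventually_nonzero:
  assumes "newform w M f" "\<tau>\<^sub>0 \<in> upper_half"
  shows "\<forall>\<^sub>F \<tau> in at \<tau>\<^sub>0. f \<tau> \<noteq> 0"
proof -
  obtain a where "fourier_coeffs f a" "a 1 = 1"
    using assms(1) by (auto simp: newform_def)
  then obtain \<beta> where \<beta>: "\<beta> \<in> upper_half" "f \<beta> \<noteq> 0"
    using fourier_coeffs_nonzero[of f a 1] by auto
  have "f holomorphic_on upper_half"
    using assms(1) by (simp add: newform_def cusp_form_def)
  moreover have "connected upper_half"
    by (simp add: upper_half_def convex_connected convex_halfspace_Im_gt)
  ultimately have "\<forall>\<^sub>F \<tau> in at \<tau>\<^sub>0. f \<tau> \<noteq> 0 \<and> \<tau> \<in> upper_half"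
    using open_upper_half assms(2) \<beta> by (intro non_zero_neighbour_alt)
  then show ?thesis by (rule eventually_mono) simp
qed

section \<open>Holomorphy of the modular form and the fibre over the origin\<close>

theorem proposition5:
  fixes N k :: nat
    and E :: curve
    and f :: "complex \<Rightarrow> complex"
    and \<Phi> :: "complex option set \<Rightarrow> ec_point"
  assumes "N \<ge> 1"
    and "k \<in> {4, 6, 8, 12}"
    and "elliptic_curve E"
    and "curve_type k E"
    and "newform 2 (k\<^sup>2 div 4 * N) f"
    and "rational_coeffs f"
    and "modular_parametrization (Gamma_k N k) E \<Phi>"
    and "\<forall>\<tau>\<in>upper_half. invariant_differential_pullback E (lift (Gamma_k N k) \<Phi>) \<tau> =
           4 * of_real pi * \<i> / of_nat k * f (2 * \<tau> / of_nat k)"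
  shows "(Q_form N k f \<Phi> holomorphic_on upper_half \<and>
          holomorphic_at_cusps 4 (Gamma_k N k) (Q_form N k f \<Phi>)) \<longleftrightarrow>
         {p \<in> modular_curve (Gamma_k N k). \<Phi> p = Origin} \<subseteq> cusps (Gamma_k N k)"
proof -
  define \<Gamma> where "\<Gamma> = Gamma_k N k"
  define \<phi> where "\<phi> = lift \<Gamma> \<Phi>"
  define \<omega> where "\<omega> = invariant_differential_pullback E \<phi>"
  define c where "c = 4 * of_real pi * \<i> / of_nat k"
  define Q where "Q = Q_form N k f \<Phi>"
  define P where "P = (\<lambda>\<tau>. x_coord (\<phi> \<tau>) * Delta_root k f \<tau>)"
  have k: "k \<ge> 2" using assms(2) by auto
  have c: "c \<noteq> 0" using k by (simp add: c_def)
  have Q: "Q = remove_sings P"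
    by (simp add: Q_def P_def Q_form_def \<phi>_def \<Gamma>_def)
  have \<Phi>: "holomorphic_map \<Gamma> E \<Phi>"
    using assms(7) by (simp add: modular_parametrization_def \<Gamma>_def)
  have an: "curve_analytic_at E \<phi> \<tau>" if "\<tau> \<in> upper_half" for \<tau>
    unfolding \<phi>_def by (rule curve_analytic_at_lift[OF \<Phi> that])
  have \<omega>: "\<omega> \<tau> = c * f (2 * \<tau> / of_nat k)" if "\<tau> \<in> upper_half" for \<tau>
    using assms(8) that by (simp add: \<omega>_def \<phi>_def \<Gamma>_def c_def)
  then have P_eq: "P \<tau> = (1 / c\<^sup>2) * (x_coord (\<phi> \<tau>) * (\<omega> \<tau>)\<^sup>2)" if "\<tau> \<in> upper_half" for \<tau>
    using that c by (simp add: P_def Delta_root_def power_mult_distrib)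
  have one: "mat 1 \<in> \<Gamma>"
    by (simp add: \<Gamma>_def Gamma_k_def Gamma0_def Gamma_upper0_def SL2Z_def mat_def det_2)

  have scale: "2 * \<tau> / of_nat k \<in> upper_half" if "\<tau> \<in> upper_half" for \<tau>
    using that k by (simp add: upper_half_def)
  have no_zero: "\<exists>\<^sub>F \<tau> in at \<tau>\<^sub>0. \<omega> \<tau> \<noteq> 0" if \<tau>\<^sub>0: "\<tau>\<^sub>0 \<in> upper_half" for \<tau>\<^sub>0
  proof -
    have "filterlim (\<lambda>\<tau>. 2 * \<tau> / of_nat k) (at (2 * \<tau>\<^sub>0 / of_nat k)) (at \<tau>\<^sub>0)"
      unfolding filterlim_at using k
      by (auto intro!: tendsto_eq_intros eventually_at_in_open' simp: eventually_at_filter)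
    from eventually_compose_filterlim[OF newform_eventually_nonzero[OF assms(5) scale[OF \<tau>\<^sub>0]] this]
    have "\<forall>\<^sub>F \<tau> in at \<tau>\<^sub>0. f (2 * \<tau> / of_nat k) \<noteq> 0" .
    moreover have "\<forall>\<^sub>F \<tau> in at \<tau>\<^sub>0. \<tau> \<in> upper_half"
      using \<tau>\<^sub>0 open_upper_half by (intro eventually_at_in_open')
    ultimately have "\<forall>\<^sub>F \<tau> in at \<tau>\<^sub>0. \<omega> \<tau> \<noteq> 0"
      by eventually_elim (use \<omega> c in auto)
    then show ?thesis by (intro eventually_frequently) auto
  qed

  have "{p \<in> modular_curve \<Gamma>. \<Phi> p = Origin} \<subseteq> cusps \<Gamma> \<longleftrightarrow>
      (\<forall>\<tau>\<in>upper_half. \<phi> \<tau> \<noteq> Origin)"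
    (is "?L \<longleftrightarrow> ?R")
  proof
    assume ?L
    then show ?R
      using orbit_upper_half_not_cusp[OF _ one] unfolding \<phi>_def modular_curve_def by blast
  next
    assume ?R
    then show ?L
      by (auto simp: modular_curve_def cusps_def \<phi>_def)
  qed
  moreover have "Q holomorphic_on upper_half \<and> holomorphic_at_cusps 4 \<Gamma> Q"
    if no_origin: "\<forall>\<tau>\<in>upper_half. \<phi> \<tau> \<noteq> Origin"
  proof
    have P_an: "P analytic_on {\<tau>}" if "\<tau> \<in> upper_half" for \<tau>
    proof -
      have "f analytic_on {2 * \<tau> / of_nat k}"
        using assms(5) scale[OF that] open_upper_half
        by (auto simp: newform_def cusp_form_def intro: holomorphic_on_imp_analytic_at)
      then have "f \<circ> (\<lambda>\<tau>. 2 * \<tau> / of_nat k) analytic_on {\<tau>}"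
        using k by (intro analytic_on_compose analytic_intros) auto
      moreover have "(\<lambda>\<tau>. x_coord (\<phi> \<tau>)) analytic_on {\<tau>}"
        using an[OF that] no_origin that by (intro x_coord_analytic) auto
      ultimately show ?thesis
        unfolding P_def Delta_root_def by (intro analytic_intros) (auto simp: o_def)
    qed
    then have QP: "Q \<tau> = P \<tau>" if "\<tau> \<in> upper_half" for \<tau>
      using that by (simp add: Q)
    have "P holomorphic_on upper_half"
      using P_an analytic_on_analytic_at analytic_imp_holomorphic by blast
    then show "Q holomorphic_on upper_half"
      using QP by (simp cong: holomorphic_cong)
    show "holomorphic_at_cusps 4 \<Gamma> Q"
      unfolding holomorphic_at_cusps_def
    proof
      fix \<alpha> assume \<alpha>: "\<alpha> \<in> SL2Z"
      have "cusp_width \<Gamma> \<alpha> > 0"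
        unfolding \<Gamma>_def using \<alpha> k assms(1) by (rule cusp_width_Gamma_k_pos)
      then obtain G where G: "cusp_expansion 4 \<Gamma> (\<lambda>\<tau>. x_coord (\<phi> \<tau>) * (\<omega> \<tau>)\<^sup>2) \<alpha> G"
        using cusp_expansion_x_differential_squared[OF assms(3) \<Phi> \<alpha>] unfolding \<phi>_def \<omega>_def by metis
      then have "cusp_expansion 4 \<Gamma> (\<lambda>\<tau>. (1 / c\<^sup>2) * (x_coord (\<phi> \<tau>) * (\<omega> \<tau>)\<^sup>2)) \<alpha>
          (\<lambda>z. (1 / c\<^sup>2) * G z)"
        using c unfolding cusp_expansion_def
        by (auto intro!: analytic_intros elim!: eventually_mono simp: slash_def field_simps)
      then have "cusp_expansion 4 \<Gamma> Q \<alpha> (\<lambda>z. (1 / c\<^sup>2) * G z)"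
        using QP P_eq \<alpha> by (subst cusp_expansion_cong) auto
      then show "\<exists>G. cusp_expansion 4 \<Gamma> Q \<alpha> G" by blast
    qed
  qed
  moreover have "\<phi> \<tau> \<noteq> Origin" if hol: "Q holomorphic_on upper_half" and \<tau>: "\<tau> \<in> upper_half" for \<tau>
  proof
    assume "\<phi> \<tau> = Origin"
    note pole = is_pole_x_differential_squared[OF assms(3) an[OF \<tau>] this no_zero[OF \<tau>, unfolded \<omega>_def],
        folded \<omega>_def]
    have "\<forall>\<^sub>F t in at \<tau>. t \<in> upper_half"
      using \<tau> open_upper_half by (intro eventually_at_in_open')
    then have ev: "\<forall>\<^sub>F t in at \<tau>. P t = (1 / c\<^sup>2) * (x_coord (\<phi> t) * (\<omega> t)\<^sup>2)"
      by eventually_elim (rule P_eq)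
    have iso: "isolated_singularity_at P \<tau>"
      unfolding isolated_singularity_at_cong[OF ev refl]
      by (intro singularity_intros pole(2) isolated_singularity_at_analytic analytic_intros)
    have "is_pole P \<tau>"
      unfolding is_pole_cong[OF ev refl] using c pole(1) by (subst is_pole_cmult_iff) auto
    then have "is_pole Q \<tau>"
      unfolding Q using iso by (subst is_pole_remove_sings_iff)
    moreover have "\<not> is_pole Q \<tau>"
      using hol open_upper_half \<tau> by (rule not_is_pole_holomorphic[rotated -1])
    ultimately show False by blast
  qed
  ultimately show ?thesis
    unfolding Q_def \<Gamma>_def by blast
qed

end
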